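(* Let $p\ge1$ and $A,n,r_1,\dots,r_p\ge0$ be integers, and let $\xi\in\mathbb{C}^*$ with $\xi^p=1$. Let $\mathbb{K}=\mathbb{Q}(\xi)$ and let $P\in\mathbb{K}[k_1,\dots,k_p]$ satisfy $\sum_{i=1}^j\deg_{k_i}P\le jA(n+1)-j-1$ for every $j\in\{1,\dots,p\}$ and, writing $P$ as a polynomial in $K_i=k_i+r_i+\frac n2$, $$P(K_2,K_3,\dots,K_p,K_1)=\xi\,P(K_1,\dots,K_p).$$ Let $S=\sum_{k_1\ge\dots\ge k_p\ge1}P(k_1,\dots,k_p)/\big((k_1+r_1)_{n+1}^A\cdots(k_p+r_p)_{n+1}^A\big)$. Then there exists an admissible representation $(\lambda[s_1,\dots,s_q])$ of $S$ whose depth $p$ part $\sum_{s_1,\dots,s_p}\lambda[s_1,\dots,s_p]\zeta(s_1,\dots,s_p)$ is a $\mathbb{K}$-linear combination of the numbers $$\sum_{i=1}^p\xi^{i-1}\zeta(s_i,s_{i+1},\dots,s_p,s_1,s_2,\dots,s_{i-1})$$ with $s_1,\dots,s_p\ge2$.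
   Context: $(k)_\alpha=k(k+1)\cdots(k+\alpha-1)$; $\zeta(s_1,\dots,s_q)=\sum_{k_1>\dots>k_q\ge1}k_1^{-s_1}\cdots k_q^{-s_q}$ ($s_1\ge2$), $\zeta(\emptyset)=1$. Here $A_i=A$ and $n_i=n$ for all $i$. Admissible representation of $S$: coefficients $\lambda[s_1,\dots,s_q]\in\mathbb{K}$, indexed by tuples of positive integers with $0\le q\le p$ and $s_1\ge2$ when $q\ge1$, finitely many nonzero, with $S=\sum\lambda[s_1,\dots,s_q]\zeta(s_1,\dots,s_q)$, such that whenever $\lambda[s_1,\dots,s_q]\ne0$, $q\ge1$: (a) there exist $1=\ell_0<\dots<\ell_q=p+1$ with $s_j\le(\ell_j-\ell_{j-1})A$ for all $j$; (b) if $r_i\ge r_{i+1}+n+1$ for all $i\le p-1$, then $1\le s_\ell\le A$ for all $\ell$, and the number of $\ell$ with $s_\ell=1$ is at most the number of $i$ with $\deg_{k_i}P\ge A(n+1)-1$. *)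

theory Defs
  imports "HOL-Analysis.Analysis" "HOL-Library.Poly_Mapping"
begin

text \<open>All tuples and variables are indexed from 0: the polynomial variable with index \<open>i\<close> is
  \<open>k\<^sub>i\<^sub>+\<^sub>1\<close>, and \<open>r i\<close> is \<open>r\<^sub>i\<^sub>+\<^sub>1\<close>.\<close>

definition subfield_of_complex :: "complex set \<Rightarrow> bool" where
  "subfield_of_complex F \<longleftrightarrow>
     1 \<in> F \<and> (\<forall>x\<in>F. \<forall>y\<in>F. x - y \<in> F \<and> x * y \<in> F) \<and> (\<forall>x\<in>F. x \<noteq> 0 \<longrightarrow> inverse x \<in> F)"

definition rat_adjoin :: "complex \<Rightarrow> complex set" where
  "rat_adjoin \<xi> = subfield_of_complex hull {\<xi>}"

text \<open>A polynomial is a finitely supported map from monomials to coefficients, a monomial being a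
  finitely supported map from variable indices to exponents; multiplication is the convolution
  product of \<^theory>\<open>HOL-Library.Poly_Mapping\<close>.\<close>

type_synonym cmpoly = "(nat \<Rightarrow>\<^sub>0 nat) \<Rightarrow>\<^sub>0 complex"

definition mConst :: "complex \<Rightarrow> cmpoly" where
  "mConst c = Poly_Mapping.single 0 c"

definition mVar :: "nat \<Rightarrow> cmpoly" where
  "mVar i = Poly_Mapping.single (Poly_Mapping.single i 1) 1"

definition mpolys_over :: "complex set \<Rightarrow> nat \<Rightarrow> cmpoly set" where
  "mpolys_over K p =
     {P. (\<forall>m. Poly_Mapping.lookup P m \<in> K) \<and>
         (\<forall>m\<in>Poly_Mapping.keys P. Poly_Mapping.keys m \<subseteq> {..<p})}"

definition minsertion ::
    "(complex \<Rightarrow> 'b) \<Rightarrow> (nat \<Rightarrow> 'b) \<Rightarrow> cmpoly \<Rightarrow> 'b::comm_ring_1" where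
  "minsertion h x P =
     (\<Sum>m\<in>Poly_Mapping.keys P. h (Poly_Mapping.lookup P m) *
        (\<Prod>i\<in>Poly_Mapping.keys m. x i ^ Poly_Mapping.lookup m i))"

abbreviation meval :: "(nat \<Rightarrow> complex) \<Rightarrow> cmpoly \<Rightarrow> complex" where
  "meval \<equiv> minsertion (\<lambda>c. c)"

abbreviation msubst :: "(nat \<Rightarrow> cmpoly) \<Rightarrow> cmpoly \<Rightarrow> cmpoly" where
  "msubst \<equiv> minsertion mConst"

text \<open>The supremum of the empty set is \<open>-\<infinity>\<close>, which is the degree of the zero polynomial.\<close>

definition mdegree :: "nat \<Rightarrow> cmpoly \<Rightarrow> ereal" where
  "mdegree i P =
     (SUP m\<in>Poly_Mapping.keys P. ereal (real (Poly_Mapping.lookup m i)))"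

text \<open>The empty list gives \<open>\<zeta>(\<emptyset>) = 1\<close>, because the index set is then \<open>{[]}\<close>.\<close>

definition mzv :: "nat list \<Rightarrow> real" where
  "mzv s =
     (\<Sum>\<^sub>\<infinity>ks\<in>{ks :: nat list. length ks = length s \<and> sorted_wrt (>) ks \<and> (\<forall>k\<in>set ks. 1 \<le> k)}.
        \<Prod>j<length s. 1 / real (ks ! j) ^ (s ! j))"

definition multiple_sum :: "nat \<Rightarrow> nat \<Rightarrow> nat \<Rightarrow> (nat \<Rightarrow> nat) \<Rightarrow> cmpoly \<Rightarrow> complex" where
  "multiple_sum p A n r P =
     (\<Sum>\<^sub>\<infinity>ks\<in>{ks :: nat list. length ks = p \<and> sorted_wrt (\<ge>) ks \<and> (\<forall>k\<in>set ks. 1 \<le> k)}.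
        meval (\<lambda>i. of_nat (ks ! i)) P /
        (\<Prod>i<p. pochhammer (of_nat (ks ! i + r i)) (n + 1) ^ A))"

text \<open>A family indexed by the tuples of depth at most \<open>p\<close> with positive entries and leading entry
  at least 2 is a function on all lists that vanishes at every other list.\<close>

definition admissible_representation ::
    "complex set \<Rightarrow> nat \<Rightarrow> nat \<Rightarrow> nat \<Rightarrow> (nat \<Rightarrow> nat) \<Rightarrow> cmpoly \<Rightarrow> complex \<Rightarrow>
     (nat list \<Rightarrow> complex) \<Rightarrow> bool" where
  "admissible_representation K p A n r P S c \<longleftrightarrow>
     (\<forall>s. c s \<in> K) \<and>
     finite {s. c s \<noteq> 0} \<and>
     (\<forall>s. c s \<noteq> 0 \<longrightarrow>
        length s \<le> p \<and> (\<forall>x\<in>set s. 1 \<le> x) \<and> (s \<noteq> [] \<longrightarrow> 2 \<le> hd s)) \<and>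
     S = (\<Sum>s | c s \<noteq> 0. c s * of_real (mzv s)) \<and>
     (\<forall>s. c s \<noteq> 0 \<and> s \<noteq> [] \<longrightarrow>
        (\<exists>l :: nat \<Rightarrow> nat. l 0 = 1 \<and> l (length s) = p + 1 \<and>
           (\<forall>j<length s. l j < l (j + 1) \<and> s ! j \<le> (l (j + 1) - l j) * A)) \<and>
        ((\<forall>i. i + 1 < p \<longrightarrow> r i \<ge> r (i + 1) + n + 1) \<longrightarrow>
           (\<forall>x\<in>set s. 1 \<le> x \<and> x \<le> A) \<and>
           card {j. j < length s \<and> s ! j = 1} \<le>
             card {i. i < p \<and> mdegree i P \<ge> ereal (real A * (real n + 1) - 1)}))"

definition linear_combinations :: "complex set \<Rightarrow> complex set \<Rightarrow> complex set" where
  "linear_combinations K X =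
     {\<Sum>x\<in>F. a x * x | F a. finite F \<and> F \<subseteq> X \<and> (\<forall>x\<in>F. a x \<in> K)}"

end

theory Submission
  imports Defs
begin

text \<open>The cyclic symmetry makes all partial degrees of \<open>P\<close> equal, hence at most \<open>A(n+1)-2\<close>: the summand
  decays like \<open>k\<^sub>i\<^sup>-\<^sup>2\<close> in every variable. By linearity it may be replaced by a product of
  one-variable fractions \<open>K\<^sub>i\<^sup>m / (k\<^sub>i + r\<^sub>i)\<^sub>n\<^sub>+\<^sub>1\<^sup>A\<close>, whose partial fraction expansions have vanishing sum of
  residues. Summing over \<open>k\<^sub>1\<close>, then \<open>k\<^sub>2\<close>, and so on produces rational functions times tails of multiple
  zeta values; poles of order 1 only occur in differences, which telescope, so that all entries are at
  least 2. The coefficient of \<open>\<zeta>(s\<^sub>1, \<dots>, s\<^sub>p)\<close> is obtained by adding, in each variable, the partial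
  fraction coefficients of order \<open>s\<^sub>i\<close>. It does not see the shifts \<open>r\<^sub>i\<close>, so it inherits the
  cyclic symmetry of \<open>P\<close>, and averaging over the rotations gives the claim.\<close>

text \<open>Depth, pole orders and pole positions must be controlled together, so \<open>adm\<close>
  and the spans \<open>presums\<close> and \<open>postsums\<close> carry all three through each
  summation. The mechanism is that tails at two arguments differ by finitely many terms with a
  shorter tail. Multiplying a tail by a pole at another position therefore costs only smaller depth.
  That is why an explicit part of maximal depth, plus an error known only up to its span, is a
  strong enough invariant for the induction. Expanding \<open>P\<close> in the variables
  \<open>K_i\<close> makes the \<open>i\<close>-th factor a translate by \<open>r_i\<close> of a
  function of its exponent alone, so the symmetry becomes a mere rotation of exponents. Degree
  control starts from the case \<open>j = 1\<close> of the hypothesis, which bounds the first degree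
  by \<open>A * (n + 1) - 1 - 1\<close>. All of the analysis is real with rational coefficients; the
  field \<open>K\<close> enters through the coefficients of \<open>Q\<close>. In maximal depth,
  \<open>p\<close> ceilings of \<open>s_j / A\<close>, each at least 1, have sum at most
  \<open>p\<close>, which confines the entries to \<open>{2..A}\<close>.\<close>

section \<open>Nested sums and their tails\<close>

text \<open>Phrased through \<open>has_sum\<close> for all starting points at once: summability
  travels with the value, so the algebraic rules need no side conditions, and \<open>F\<close> can
  serve as a factor of the summand for the next variable.\<close>

definition tail_sum :: "(nat \<Rightarrow> real) \<Rightarrow> (nat \<Rightarrow> real) \<Rightarrow> bool" where
  "tail_sum f F \<longleftrightarrow> (\<forall>y. (f has_sum F y) {y..})"

lemma tail_sum_infsum:
  assumes "f summable_on UNIV"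
  shows "tail_sum f (\<lambda>y. infsum f {y..})"
  unfolding tail_sum_def
  using summable_on_subset_banach[OF assms] by (auto intro!: has_sum_infsum)

lemma tail_sum_zero: "tail_sum (\<lambda>_. 0) (\<lambda>_. 0)"
  by (simp add: tail_sum_def)

lemma tail_sum_lincomb:
  assumes "tail_sum f F" "tail_sum g G"
  shows "tail_sum (\<lambda>x. c * f x + g x) (\<lambda>x. c * F x + G x)"
  using assms unfolding tail_sum_def by (auto intro!: has_sum_add has_sum_cmult_right)

lemma tail_sum_add:
  assumes "tail_sum f F" "tail_sum g G"
  shows "tail_sum (\<lambda>x. f x + g x) (\<lambda>x. F x + G x)"
  using tail_sum_lincomb[OF assms, of 1] by simp

lemma tail_sum_cmult: "tail_sum f F \<Longrightarrow> tail_sum (\<lambda>x. c * f x) (\<lambda>x. c * F x)"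
  unfolding tail_sum_def by (auto intro!: has_sum_cmult_right)

lemma tail_sum_sum:
  assumes "\<And>i. i \<in> I \<Longrightarrow> tail_sum (f i) (F i)"
  shows "tail_sum (\<lambda>x. \<Sum>i\<in>I. f i x) (\<lambda>x. \<Sum>i\<in>I. F i x)"
  using assms
  by (induction I rule: infinite_finite_induct) (auto intro!: tail_sum_zero tail_sum_add)

lemma tail_sum_shift:
  assumes "tail_sum f F"
  shows "tail_sum (\<lambda>x. f (x + j)) (\<lambda>y. F (y + j))"
  unfolding tail_sum_def
proof
  fix y :: nat
  have "bij_betw (\<lambda>x. x + j) {y..} {y + j..}"
    by (rule bij_betw_byWitness[where f' = "\<lambda>x. x - j"]) auto
  from has_sum_reindex_bij_betw[OF this, of f] assms
  show "((\<lambda>x. f (x + j)) has_sum F (y + j)) {y..}"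
    by (simp add: tail_sum_def)
qed

text \<open>Monotonicity makes the summands nonnegative, which upgrades the convergent telescoping
  series to an unordered sum.\<close>

lemma tail_sum_telescope:
  fixes g :: "nat \<Rightarrow> real"
  assumes "\<And>x. g (Suc x) \<le> g x" and "g \<longlonglongrightarrow> 0"
  shows "tail_sum (\<lambda>x. g x - g (Suc x)) g"
  unfolding tail_sum_def
proof
  fix y :: nat
  have "bij_betw (\<lambda>x. x + y) UNIV {y..}"
    by (rule bij_betw_byWitness[where f' = "\<lambda>x. x - y"]) auto
  note r = has_sum_reindex_bij_betw[OF this, of "\<lambda>x. g x - g (Suc x)" "g y"]
  have "(\<lambda>i. g (i + y)) \<longlonglongrightarrow> 0"
    using assms(2) by (rule LIMSEQ_ignore_initial_segment)
  from telescope_sums'[OF this]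
  have "(\<lambda>i. g (i + y) - g (Suc (i + y))) sums g y" by simp
  then have "((\<lambda>i. g (i + y) - g (Suc (i + y))) has_sum g y) UNIV"
    by (rule sums_nonneg_imp_has_sum) (use assms(1) in auto)
  with r show "((\<lambda>x. g x - g (Suc x)) has_sum g y) {y..}" by simp
qed

text \<open>A function list is read from the innermost summation variable outwards, hence reversed with
  respect to the tuple \<open>(k\<^sub>1, k\<^sub>2, \<dots>)\<close>. Variables are shifted by one, \<open>x\<close> standing for the index
  \<open>k = x + 1\<close>, so that no denominator vanishes at \<open>x = 0\<close>. The parameter \<open>d\<close> is 0 for
  weakly and 1 for strictly decreasing indices.\<close>

fun nested_sum :: "nat \<Rightarrow> (nat \<Rightarrow> real) list \<Rightarrow> nat \<Rightarrow> real" where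
  "nested_sum d [] y = 1"
| "nested_sum d (f # fs) y = (\<Sum>\<^sub>\<infinity>x\<in>{y..}. f x * nested_sum d fs (x + d))"

text \<open>At \<open>y = 0\<close>, \<open>d = 0\<close> yields the index set of
  \<open>multiple_sum\<close> and \<open>d = 1\<close> that of \<open>mzv\<close>, so one summation
  lemma serves both.\<close>

definition chains :: "nat \<Rightarrow> nat \<Rightarrow> nat \<Rightarrow> nat list set" where
  "chains d m y = {ks. length ks = m \<and> sorted_wrt (\<lambda>a b. b + d \<le> a) ks \<and> (\<forall>k\<in>set ks. y < k)}"

definition list_prod :: "(nat \<Rightarrow> real) list \<Rightarrow> nat list \<Rightarrow> real" where
  "list_prod fs ks = (\<Prod>i<length fs. (rev fs ! i) (ks ! i - 1))"

lemma list_prod_snoc: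
  assumes "length ks = length fs"
  shows "list_prod (f # fs) (ks @ [Suc x]) = f x * list_prod fs ks"
proof -
  have "(\<Prod>i<length fs. ((rev fs @ [f]) ! i) ((ks @ [Suc x]) ! i - 1)) =
        (\<Prod>i<length fs. (rev fs ! i) (ks ! i - 1))"
    by (rule prod.cong) (use assms in \<open>auto simp: nth_append\<close>)
  then show ?thesis
    using assms by (simp add: list_prod_def nth_append)
qed

lemma chains_snoc_bij:
  "bij_betw (\<lambda>(x, ks). ks @ [Suc x]) (SIGMA x:{y..}. chains d m (x + d)) (chains d (Suc m) y)"
proof (rule bij_betw_byWitness[where f' = "\<lambda>ks. (last ks - 1, butlast ks)"])
  show "\<forall>a\<in>SIGMA x:{y..}. chains d m (x + d).
      (last (case a of (x, ks) \<Rightarrow> ks @ [Suc x]) - 1,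
       butlast (case a of (x, ks) \<Rightarrow> ks @ [Suc x])) = a"
    by auto
  have key: "\<exists>x ks. l = ks @ [Suc x] \<and> y \<le> x \<and> ks \<in> chains d m (x + d)"
    if "l \<in> chains d (Suc m) y" for l
  proof (cases l rule: rev_cases)
    case Nil
    then show ?thesis using that by (simp add: chains_def)
  next
    case (snoc ks k)
    then have "y < k" using that by (simp add: chains_def)
    then obtain x where "k = Suc x" "y \<le> x" by (cases k) auto
    moreover have "ks \<in> chains d m (x + d)"
      using that snoc \<open>k = Suc x\<close> by (auto simp: chains_def sorted_wrt_append Suc_le_eq)
    ultimately show ?thesis using snoc by blast
  qed
  show "\<forall>l\<in>chains d (Suc m) y. (case (last l - 1, butlast l) of (x, ks) \<Rightarrow> ks @ [Suc x]) = l"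
    using key by fastforce
  show "(\<lambda>(x, ks). ks @ [Suc x]) ` (SIGMA x:{y..}. chains d m (x + d)) \<subseteq> chains d (Suc m) y"
    by (fastforce simp: chains_def sorted_wrt_append Suc_le_eq)
  show "(\<lambda>ks. (last ks - 1, butlast ks)) ` chains d (Suc m) y \<subseteq> (SIGMA x:{y..}. chains d m (x + d))"
    using key by fastforce
qed

text \<open>Absolute summability is what permits the reordering in
  \<open>nested_sum_eq_infsum\<close>. The bound \<open>C\<close> has to be uniform in
  \<open>y\<close> because the inner sum starts at the running index \<open>x + d\<close>; the outer
  summand is then dominated by \<open>C * \<bar>f x\<bar>\<close>.\<close>

lemma list_prod_abs_bounded:
  assumes "\<forall>f\<in>set fs. f summable_on UNIV"
  shows "\<exists>C. \<forall>y. ((\<lambda>ks. \<bar>list_prod fs ks\<bar>) summable_on chains d (length fs) y) \<and>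
               (\<Sum>\<^sub>\<infinity>ks\<in>chains d (length fs) y. \<bar>list_prod fs ks\<bar>) \<le> C"
  using assms
proof (induction fs)
  case Nil
  have "chains d 0 y = {[]}" for y by (auto simp: chains_def)
  then show ?case by (auto simp: list_prod_def)
next
  case (Cons f fs)
  then obtain C where C: "\<And>y. (\<lambda>ks. \<bar>list_prod fs ks\<bar>) summable_on chains d (length fs) y"
    "\<And>y. (\<Sum>\<^sub>\<infinity>ks\<in>chains d (length fs) y. \<bar>list_prod fs ks\<bar>) \<le> C" by auto
  have f: "(\<lambda>x. \<bar>f x\<bar>) summable_on UNIV"
    using Cons.prems summable_on_iff_abs_summable_on_real by auto
  define h where "h = (\<lambda>(x, ks). \<bar>f x\<bar> * \<bar>list_prod fs ks\<bar>)"
  define g where "g = (\<lambda>x. \<bar>f x\<bar> * (\<Sum>\<^sub>\<infinity>ks\<in>chains d (length fs) (x + d). \<bar>list_prod fs ks\<bar>))"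
  have C0: "C \<ge> 0"
    using C(2)[of 0] infsum_nonneg[of "chains d (length fs) 0" "\<lambda>ks. \<bar>list_prod fs ks\<bar>"] by linarith
  have g0: "0 \<le> g x" "g x \<le> C * \<bar>f x\<bar>" for x
    using mult_left_mono[OF C(2)[of "x + d"], of "\<bar>f x\<bar>"]
    by (auto simp: g_def mult.commute[of C] intro!: mult_nonneg_nonneg infsum_nonneg)
  have "(\<lambda>x. C * \<bar>f x\<bar>) summable_on UNIV" using f by (rule summable_on_cmult_right)
  then have gU: "g summable_on UNIV"
    by (rule summable_on_comparison_test) (use g0 in auto)
  then have gs: "g summable_on {y..}" for y
    by (rule summable_on_subset_banach) auto
  have inner: "((\<lambda>ks. h (x, ks)) has_sum g x) (chains d (length fs) (x + d))" for x
    unfolding h_def g_def using C(1) by (auto intro!: has_sum_cmult_right)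
  have hs: "h summable_on (SIGMA x:{y..}. chains d (length fs) (x + d))" for y
    by (rule summable_on_SigmaI[OF inner gs]) (auto simp: h_def)
  have eq: "((\<lambda>ks. \<bar>list_prod (f # fs) ks\<bar>) has_sum S) (chains d (length (f # fs)) y) \<longleftrightarrow>
      (h has_sum S) (SIGMA x:{y..}. chains d (length fs) (x + d))" for y S
  proof -
    have "((\<lambda>ks. \<bar>list_prod (f # fs) ks\<bar>) has_sum S) (chains d (length (f # fs)) y) \<longleftrightarrow>
      ((\<lambda>a. \<bar>list_prod (f # fs) (case a of (x, ks) \<Rightarrow> ks @ [Suc x])\<bar>) has_sum S)
        (SIGMA x:{y..}. chains d (length fs) (x + d))"
      using has_sum_reindex_bij_betw[OF chains_snoc_bij[of y d "length fs"],
          of "\<lambda>ks. \<bar>list_prod (f # fs) ks\<bar>" S] by simp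
    also have "\<dots> \<longleftrightarrow> (h has_sum S) (SIGMA x:{y..}. chains d (length fs) (x + d))"
      by (intro has_sum_cong) (auto simp: h_def chains_def list_prod_snoc abs_mult)
    finally show ?thesis .
  qed
  have hsum: "(h has_sum infsum g {y..}) (SIGMA x:{y..}. chains d (length fs) (x + d))" for y
    by (rule has_sum_SigmaI[OF inner has_sum_infsum[OF gs] hs])
  have "infsum g {y..} \<le> infsum g UNIV" for y
    by (rule infsum_mono2[OF gs gU]) (use g0 in auto)
  then show ?case
    using eq hsum by (intro exI[of _ "infsum g UNIV"]) (metis has_sum_imp_summable infsumI)
qed

lemma nested_sum_eq_infsum:
  assumes "\<forall>f\<in>set fs. f summable_on UNIV"
  shows "(list_prod fs has_sum nested_sum d fs y) (chains d (length fs) y)"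
  using assms
proof (induction fs arbitrary: y)
  case Nil
  have "chains d 0 y = {[]}" for y by (auto simp: chains_def)
  then show ?case by (auto simp: list_prod_def has_sum_finite_iff)
next
  case (Cons f fs)
  let ?S = "SIGMA x:{y..}. chains d (length fs) (x + d)"
  let ?h = "\<lambda>(x, ks). f x * list_prod fs ks"
  have "(\<lambda>ks. \<bar>list_prod (f # fs) ks\<bar>) summable_on chains d (length (f # fs)) y"
    using list_prod_abs_bounded[OF Cons.prems, of d] by blast
  then have sm: "list_prod (f # fs) summable_on chains d (length (f # fs)) y"
    using summable_on_iff_abs_summable_on_real[of "list_prod (f # fs)" "chains d (length (f # fs)) y"]
    by simp
  have eq: "(list_prod (f # fs) has_sum S) (chains d (length (f # fs)) y) \<longleftrightarrow> (?h has_sum S) ?S" for S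
  proof -
    have "(list_prod (f # fs) has_sum S) (chains d (length (f # fs)) y) \<longleftrightarrow>
      ((\<lambda>a. list_prod (f # fs) (case a of (x, ks) \<Rightarrow> ks @ [Suc x])) has_sum S) ?S"
      using has_sum_reindex_bij_betw[OF chains_snoc_bij[of y d "length fs"],
          of "list_prod (f # fs)" S] by simp
    also have "\<dots> \<longleftrightarrow> (?h has_sum S) ?S"
      by (intro has_sum_cong) (auto simp: chains_def list_prod_snoc)
    finally show ?thesis .
  qed
  have hs: "?h summable_on ?S"
    using sm eq by (meson has_sum_imp_summable has_sum_infsum)
  have "infsum ?h ?S = (\<Sum>\<^sub>\<infinity>x\<in>{y..}. \<Sum>\<^sub>\<infinity>ks\<in>chains d (length fs) (x + d). f x * list_prod fs ks)"
    using infsum_Sigma_banach[OF hs] by simp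
  also have "\<dots> = nested_sum d (f # fs) y"
  proof -
    have "(\<Sum>\<^sub>\<infinity>ks\<in>chains d (length fs) z. f x * list_prod fs ks) = f x * nested_sum d fs z" for x z
      by (rule infsumI, rule has_sum_cmult_right) (use Cons in auto)
    then show ?thesis by simp
  qed
  finally show ?case
    using eq hs has_sum_infsum by metis
qed

section \<open>Poles, and tails of multiple zeta values\<close>

definition pole :: "nat \<Rightarrow> nat \<Rightarrow> nat \<Rightarrow> real" where
  "pole t j x = 1 / real (x + j + 1) ^ t"

definition ztail :: "nat list \<Rightarrow> nat \<Rightarrow> real" where
  "ztail s = nested_sum 1 (map (\<lambda>t. pole t 0) s)"

text \<open>Pole and tail are matched: if \<open>x + j\<close> is the index at the pole, the tail
  runs over the strictly larger ones. Exactly this pairing is a summand of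
  \<open>ztail (t # s)\<close>, translated by \<open>j\<close>, and so sums in closed form.\<close>

definition zterm :: "nat list \<Rightarrow> nat \<Rightarrow> nat \<Rightarrow> nat \<Rightarrow> real" where
  "zterm s t j x = pole t j x * ztail s (x + j + 1)"

lemma pole_nonneg: "0 \<le> pole t j x" by (simp add: pole_def)

lemma pole_shift: "pole t j (x + i) = pole t (i + j) x" by (simp add: pole_def add_ac)

lemma pole_antimono: "pole t j (Suc x) \<le> pole t j x"
  by (auto simp: pole_def intro!: divide_left_mono power_mono)

lemma pole_le: assumes "2 \<le> t" shows "pole t j x \<le> pole 2 0 x"
proof -
  have "real (x + 0 + 1) ^ 2 \<le> real (x + j + 1) ^ 2" by (intro power_mono) auto
  also have "\<dots> \<le> real (x + j + 1) ^ t" by (intro power_increasing assms) auto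
  finally show ?thesis unfolding pole_def by (intro divide_left_mono) auto
qed

lemma pole2_summable: "pole 2 0 summable_on UNIV"
proof (rule summable_nonneg_imp_summable_on)
  have "summable (\<lambda>n. inverse (real n ^ 2))" by (rule inverse_power_summable) simp
  then have "summable (\<lambda>n. inverse (real (Suc n) ^ 2))" by (subst summable_Suc_iff)
  then show "summable (pole 2 0)" by (simp add: pole_def [abs_def] inverse_eq_divide)
qed (simp add: pole_nonneg)

lemma pole_summable:
  assumes "2 \<le> t"
  shows "pole t j summable_on UNIV"
  by (rule summable_on_comparison_test[OF pole2_summable]) (use pole_le[OF assms] pole_nonneg in auto)

lemma pole1_tendsto: "pole 1 j \<longlonglongrightarrow> 0"
proof -
  have "(\<lambda>x. inverse (real (Suc (x + j)))) \<longlonglongrightarrow> 0"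
    using LIMSEQ_ignore_initial_segment[OF LIMSEQ_inverse_real_of_nat, of j] by simp
  then show ?thesis by (simp add: pole_def [abs_def] inverse_eq_divide add.commute)
qed

lemma ztail_Nil [simp]: "ztail [] y = 1" by (simp add: ztail_def)

lemma ztail_Cons: "ztail (t # s) y = (\<Sum>\<^sub>\<infinity>x\<in>{y..}. zterm s t 0 x)"
  by (simp add: ztail_def zterm_def)

text \<open>Proved together, because the induction needs nonnegative and bounded inner tails for
  summability. Monotonicity is used later, for telescoping against simple poles.\<close>

lemma ztail_bounds:
  assumes "\<forall>t\<in>set s. 2 \<le> t"
  shows "0 \<le> ztail s y" "ztail s (Suc y) \<le> ztail s y" "ztail s y \<le> ztail s 0"
proof -
  have P: "0 \<le> ztail s y \<and> ztail s (Suc y) \<le> ztail s y \<and> ztail s y \<le> ztail s 0" for y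
    using assms
  proof (induction s arbitrary: y)
    case (Cons t s)
    have b: "0 \<le> zterm s t 0 x" "zterm s t 0 x \<le> pole t 0 x * ztail s 0" for x
      using Cons by (auto simp: zterm_def pole_nonneg intro!: mult_left_mono)
    have "(\<lambda>x. pole t 0 x * ztail s 0) summable_on UNIV"
      using Cons.prems by (intro summable_on_cmult_left pole_summable) auto
    then have sU: "zterm s t 0 summable_on UNIV"
      by (rule summable_on_comparison_test) (use b in auto)
    then have sm: "zterm s t 0 summable_on {y..}" for y
      by (rule summable_on_subset_banach) auto
    have mono: "infsum (zterm s t 0) {y'..} \<le> infsum (zterm s t 0) {y..}" if "y \<le> y'" for y y'
      by (rule infsum_mono2[OF sm sm]) (use that b in auto)
    then show ?case
      using b mono[of 0 y] mono[of y "Suc y"] by (auto simp: ztail_Cons intro!: infsum_nonneg)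
  qed auto
  show "0 \<le> ztail s y" "ztail s (Suc y) \<le> ztail s y" "ztail s y \<le> ztail s 0" using P by auto
qed

lemma zterm_summable:
  assumes "\<forall>t\<in>set s. 2 \<le> t" "2 \<le> t"
  shows "zterm s t j summable_on UNIV"
proof (rule summable_on_comparison_test)
  show "(\<lambda>x. pole t j x * ztail s 0) summable_on UNIV"
    by (intro summable_on_cmult_left pole_summable assms)
  show "zterm s t j x \<le> pole t j x * ztail s 0" "0 \<le> zterm s t j x" for x
    using ztail_bounds[OF assms(1)] by (auto simp: zterm_def pole_nonneg intro!: mult_left_mono)
qed

lemma zterm_shift: "zterm s t j (x + i) = zterm s t (i + j) x"
  by (simp add: zterm_def pole_def add_ac)

lemma tail_sum_zterm:
  assumes "\<forall>t\<in>set s. 2 \<le> t" "2 \<le> t"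
  shows "tail_sum (zterm s t j) (\<lambda>y. ztail (t # s) (y + j))"
proof -
  have "tail_sum (zterm s t 0) (\<lambda>y. ztail (t # s) y)"
    using tail_sum_infsum[OF zterm_summable[OF assms, of 0]] by (simp add: ztail_Cons)
  from tail_sum_shift[OF this, of j] show ?thesis by (simp add: zterm_shift)
qed

lemma ztail_diff_Suc:
  assumes "\<forall>t\<in>set s. 2 \<le> t" "2 \<le> t"
  shows "ztail (t # s) y - ztail (t # s) (Suc y) = zterm s t 0 y"
proof -
  have "infsum (zterm s t 0) (insert y {Suc y..}) = zterm s t 0 y + infsum (zterm s t 0) {Suc y..}"
    by (rule infsum_insert) (use summable_on_subset_banach[OF zterm_summable[OF assms, of 0]] in auto)
  moreover have "insert y {Suc y..} = {y..}" by auto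
  ultimately show ?thesis by (simp add: ztail_Cons)
qed

text \<open>Each unit step removes one summand, in which the entry \<open>t\<close> is spent as a
  pole and only the shorter tail \<open>s\<close> remains. This is the source of the depth
  reductions below.\<close>

lemma ztail_diff:
  assumes "\<forall>t\<in>set s. 2 \<le> t" "2 \<le> t" "l \<le> m"
  shows "ztail (t # s) (x + l) - ztail (t # s) (x + m) = (\<Sum>i\<in>{l..<m}. zterm s t i x)"
  using \<open>l \<le> m\<close>
proof (induction m rule: dec_induct)
  case (step m)
  have "zterm s t 0 (x + m) = zterm s t m x" using zterm_shift[of s t 0 x m] by simp
  then show ?case
    using step ztail_diff_Suc[OF assms(1,2), of "x + m"] by (simp add: sum.atLeastLessThan_Suc)
qed auto

text \<open>Raising \<open>j\<close> by one translates the function by one, so the difference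
  telescopes. The limit 0 comes from the simple pole, the tail being bounded.\<close>

lemma tail_sum_zterm1_Suc:
  assumes "\<forall>t\<in>set s. 2 \<le> t"
  shows "tail_sum (\<lambda>x. zterm s 1 j x - zterm s 1 (Suc j) x) (zterm s 1 j)"
proof -
  have "zterm s 1 j (Suc x) \<le> zterm s 1 j x" for x
    unfolding zterm_def
    by (intro mult_mono pole_antimono pole_nonneg) (use ztail_bounds[OF assms] in auto)
  moreover have "zterm s 1 j \<longlonglongrightarrow> 0"
  proof (rule tendsto_sandwich)
    show "\<forall>\<^sub>F x in sequentially. 0 \<le> zterm s 1 j x"
      using ztail_bounds[OF assms] by (auto simp: zterm_def pole_nonneg)
    show "\<forall>\<^sub>F x in sequentially. zterm s 1 j x \<le> pole 1 j x * ztail s 0"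
      using ztail_bounds[OF assms]
      by (intro always_eventually allI) (auto simp: zterm_def pole_nonneg intro!: mult_left_mono)
    show "(\<lambda>x. pole 1 j x * ztail s 0) \<longlonglongrightarrow> 0"
      using tendsto_mult_left_zero[OF pole1_tendsto] .
  qed auto
  ultimately show ?thesis
    using tail_sum_telescope[of "zterm s 1 j"] by (simp add: zterm_shift[of s 1 j _ 1, simplified])
qed

lemma tail_sum_zterm1:
  assumes "\<forall>t\<in>set s. 2 \<le> t" "i \<le> j"
  shows "tail_sum (\<lambda>x. zterm s 1 i x - zterm s 1 j x) (\<lambda>y. \<Sum>l\<in>{i..<j}. zterm s 1 l y)"
proof -
  have "tail_sum (\<lambda>x. \<Sum>l\<in>{i..<j}. zterm s 1 l x - zterm s 1 (Suc l) x) (\<lambda>y. \<Sum>l\<in>{i..<j}. zterm s 1 l y)"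
    by (intro tail_sum_sum tail_sum_zterm1_Suc assms)
  moreover have "(\<Sum>l\<in>{i..<j}. zterm s 1 l x - zterm s 1 (Suc l) x) = zterm s 1 i x - zterm s 1 j x" for x
    using sum_Suc_diff'[OF assms(2), of "\<lambda>l. - zterm s 1 l x"] by simp
  ultimately show ?thesis by simp
qed

lemma mzv_eq_ztail:
  assumes "\<forall>t\<in>set s. 2 \<le> t"
  shows "mzv s = ztail (rev s) 0"
proof -
  let ?fs = "map (\<lambda>t. pole t 0) (rev s)"
  have "(list_prod ?fs has_sum ztail (rev s) 0) (chains 1 (length ?fs) 0)"
    unfolding ztail_def by (rule nested_sum_eq_infsum) (use assms pole_summable in auto)
  then have "ztail (rev s) 0 = infsum (list_prod ?fs) (chains 1 (length ?fs) 0)"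
    by (rule infsumI[symmetric])
  also have "\<dots> = (\<Sum>\<^sub>\<infinity>ks\<in>chains 1 (length ?fs) 0. \<Prod>j<length s. 1 / real (ks ! j) ^ (s ! j))"
  proof (rule infsum_cong)
    fix ks assume ks: "ks \<in> chains 1 (length ?fs) 0"
    show "list_prod ?fs ks = (\<Prod>j<length s. 1 / real (ks ! j) ^ (s ! j))"
      unfolding list_prod_def
    proof (rule prod.cong)
      fix j assume "j \<in> {..<length s}"
      then have j: "j < length s" "0 < ks ! j" using ks by (auto simp: chains_def)
      then show "(rev ?fs ! j) (ks ! j - 1) = 1 / real (ks ! j) ^ (s ! j)"
        by (simp add: rev_map pole_def of_nat_diff)
    qed simp
  qed
  also have "\<dots> = mzv s"
    by (simp add: mzv_def chains_def Suc_le_eq)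
  finally show ?thesis by simp
qed

section \<open>Rational spans and partial fractions\<close>

text \<open>Inductive generation lets claims be checked on one generator at a time. The coefficients
  are rational so that they lie in every subfield of the complex numbers.\<close>

inductive_set qspan :: "(nat \<Rightarrow> real) set \<Rightarrow> (nat \<Rightarrow> real) set" for G where
  zero: "(\<lambda>_. 0) \<in> qspan G"
| step: "c \<in> \<rat> \<Longrightarrow> g \<in> G \<Longrightarrow> f \<in> qspan G \<Longrightarrow> (\<lambda>x. c * g x + f x) \<in> qspan G"

lemma qspan_cong: "g \<in> qspan G \<Longrightarrow> (\<And>x. f x = g x) \<Longrightarrow> f \<in> qspan G"
  by (metis ext)

lemma qspan_base: "g \<in> G \<Longrightarrow> g \<in> qspan G"
  using qspan.step[of 1 g G "\<lambda>_. 0"] qspan.zero by simp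

lemma qspan_add:
  assumes "f \<in> qspan G" "g \<in> qspan G"
  shows "(\<lambda>x. f x + g x) \<in> qspan G"
  using assms(1)
  by (induction) (use assms(2) in \<open>auto simp: add.assoc intro: qspan.step\<close>)

lemma qspan_cmult:
  assumes "f \<in> qspan G" "c \<in> \<rat>"
  shows "(\<lambda>x. c * f x) \<in> qspan G"
  using assms(1)
proof induction
  case zero
  then show ?case using qspan.zero by simp
next
  case (step d g f)
  then show ?case
    using qspan.step[of "c * d" g G "\<lambda>x. c * f x"] assms(2) by (simp add: algebra_simps)
qed

lemma qspan_diff:
  assumes "f \<in> qspan G" "g \<in> qspan G"
  shows "(\<lambda>x. f x - g x) \<in> qspan G"
  using qspan_add[OF assms(1) qspan_cmult[OF assms(2), of "-1"]] by simp

lemma qspan_sum: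
  assumes "\<And>i. i \<in> I \<Longrightarrow> f i \<in> qspan G"
  shows "(\<lambda>x. \<Sum>i\<in>I. f i x) \<in> qspan G"
  using assms
  by (induction I rule: infinite_finite_induct) (auto intro: qspan.zero qspan_add)

lemma qspan_mono: "f \<in> qspan G \<Longrightarrow> G \<subseteq> G' \<Longrightarrow> f \<in> qspan G'"
  by (induction rule: qspan.induct) (auto intro: qspan.intros)

lemma qspan_mult:
  assumes "f \<in> qspan G" "\<And>g. g \<in> G \<Longrightarrow> (\<lambda>x. g x * h x) \<in> qspan G'"
  shows "(\<lambda>x. f x * h x) \<in> qspan G'"
  using assms(1)
proof induction
  case zero
  then show ?case using qspan.zero by simp
next
  case (step c g f)
  then show ?case
    using qspan_add[OF qspan_cmult[OF assms(2)[of g], of c] step.IH] by (simp add: algebra_simps)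
qed

lemma qspan_tail_sum:
  assumes "f \<in> qspan G" "\<And>g. g \<in> G \<Longrightarrow> \<exists>F\<in>qspan G'. tail_sum g F"
  shows "\<exists>F\<in>qspan G'. tail_sum f F"
  using assms(1)
proof induction
  case zero
  then show ?case using qspan.zero tail_sum_zero by blast
next
  case (step c g f)
  then obtain F1 F2 where F: "F1 \<in> qspan G'" "tail_sum g F1" "F2 \<in> qspan G'" "tail_sum f F2"
    using assms(2) by blast
  have "(\<lambda>x. c * F1 x + F2 x) \<in> qspan G'"
    by (intro qspan_add qspan_cmult F step)
  then show ?case using tail_sum_lincomb[OF F(2,4)] by blast
qed

lemma pole_prod: "pole a j x * pole b j x = pole (a + b) j x"
  by (simp add: pole_def power_add)

lemma pole_0 [simp]: "pole 0 j x = 1" by (simp add: pole_def)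

lemma pole1_prod:
  assumes "i \<noteq> j"
  shows "pole 1 i x * pole 1 j x = 1 / (real j - real i) * (pole 1 i x - pole 1 j x)"
proof -
  have "real j - real i \<noteq> 0" "real (x + i + 1) \<noteq> 0" "real (x + j + 1) \<noteq> 0" using assms by auto
  then show ?thesis by (simp add: pole_def divide_simps)
qed

text \<open>Partial fractions with poles of order at most \<open>v j\<close> and vanishing sum of residues, that is,
  of decay \<open>O(x\<^sup>-\<^sup>2)\<close>; this is what keeps every sum below absolutely convergent and
  excludes entries 1.\<close>

definition polar :: "(nat \<Rightarrow> nat) \<Rightarrow> (nat \<Rightarrow> real) set" where
  "polar v = {pole u j | u j. 2 \<le> u \<and> u \<le> v j} \<union> {\<lambda>x. pole 1 i x - pole 1 j x | i j. 1 \<le> v i \<and> 1 \<le> v j}"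

lemma polarE: "2 \<le> u \<Longrightarrow> u \<le> v j \<Longrightarrow> pole u j \<in> qspan (polar v)"
  unfolding polar_def by (rule qspan_base) blast

lemma polarD: "1 \<le> v i \<Longrightarrow> 1 \<le> v j \<Longrightarrow> (\<lambda>x. pole 1 i x - pole 1 j x) \<in> qspan (polar v)"
  unfolding polar_def by (rule qspan_base) blast

lemma polar_mono: "(\<And>j. v j \<le> w j) \<Longrightarrow> polar v \<subseteq> polar w"
  unfolding polar_def by (rule Un_mono) (blast intro: order_trans)+

text \<open>Repeated splitting by \<open>pole1_prod\<close>, each time lowering the total order by
  one. The product decays at least quadratically, which is why simple poles survive only as a
  difference.\<close>

lemma polar_pair:
  assumes "1 \<le> a" "1 \<le> t" "i \<noteq> j" "a \<le> v i" "t \<le> v j"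
  shows "(\<lambda>x. pole a i x * pole t j x) \<in> qspan (polar v)"
  using assms
proof (induction "a + t" arbitrary: a t rule: less_induct)
  case less
  let ?c = "1 / (real j - real i)"
  obtain a' t' where at: "a = Suc a'" "t = Suc t'" using less.prems by (cases a; cases t) auto
  have eq: "pole a i x * pole t j x = ?c * (pole a i x * pole t' j x - pole a' i x * pole t j x)" for x
  proof -
    have "pole a i x * pole t j x = pole a' i x * pole t' j x * (pole 1 i x * pole 1 j x)"
      using pole_prod[of a' i x 1] pole_prod[of t' j x 1] by (simp add: at mult_ac)
    also have "\<dots> = ?c * (pole a' i x * pole t' j x * (pole 1 i x - pole 1 j x))"
      by (simp only: pole1_prod[OF less.prems(3)] mult_ac)
    also have "\<dots> = ?c * (pole a i x * pole t' j x - pole a' i x * pole t j x)"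
      using pole_prod[of a' i x 1] pole_prod[of t' j x 1] by (simp add: at algebra_simps)
    finally show ?thesis .
  qed
  have "(\<lambda>x. pole a i x * pole t' j x - pole a' i x * pole t j x) \<in> qspan (polar v)"
  \<comment> \<open>If both orders are 1, the bracket is itself a generator. Otherwise a factor that
    drops to order 0 leaves a lone pole of order at least 2.\<close>
  proof (cases "a' = 0 \<and> t' = 0")
    case True
    then show ?thesis using less.prems at polarD[of v i j] by simp
  next
    case nz: False
    have "(\<lambda>x. pole a i x * pole t' j x) \<in> qspan (polar v)" if "a' \<noteq> 0 \<or> t' \<noteq> 0"
    proof (cases "t' = 0")
      case True
      then show ?thesis using polarE[of a v i] less.prems that at by simp
    next
      case False
      then show ?thesis using less.prems at by (intro less.hyps) auto
    qed
    moreover have "(\<lambda>x. pole a' i x * pole t j x) \<in> qspan (polar v)" if "a' \<noteq> 0 \<or> t' \<noteq> 0"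
    proof (cases "a' = 0")
      case True
      then show ?thesis using polarE[of t v j] less.prems that at by simp
    next
      case False
      then show ?thesis using less.prems at by (intro less.hyps) auto
    qed
    ultimately show ?thesis using nz by (intro qspan_diff) auto
  qed
  from qspan_cmult[OF this, of ?c] show ?case
    by (rule qspan_cong) (auto simp: eq)
qed

lemma polar_mult:
  assumes "f \<in> qspan (polar v)"
  shows "(\<lambda>x. f x * pole 1 j x) \<in> qspan (polar (v(j := Suc (v j))))"
  using assms
proof (rule qspan_mult)
  let ?w = "v(j := Suc (v j))"
  have mult: "(\<lambda>x. pole u i x * pole 1 j x) \<in> qspan (polar ?w)" if "1 \<le> u" "u \<le> v i" for u i
  proof (cases "i = j")
    case True
    then show ?thesis using that polarE[of "u + 1" ?w j] by (simp add: pole_prod)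
  next
    case False
    then show ?thesis using that by (intro polar_pair) auto
  qed
  fix g assume "g \<in> polar v"
  then consider u i where "g = pole u i" "2 \<le> u" "u \<le> v i"
    | i i' where "g = (\<lambda>x. pole 1 i x - pole 1 i' x)" "1 \<le> v i" "1 \<le> v i'"
    by (auto simp: polar_def)
  then show "(\<lambda>x. g x * pole 1 j x) \<in> qspan (polar ?w)"
  proof cases
    case 1
    then show ?thesis using mult by simp
  next
    case 2
    then show ?thesis using qspan_diff[OF mult[of 1 i] mult[of 1 i']] by (simp add: left_diff_distrib)
  qed
qed

text \<open>Each numerator factor is absorbed by one pole through
  \<open>(x + 1 + c) / (x + 1 + j) = 1 + (c - j) / (x + 1 + j)\<close>, which leaves at least two poles.\<close>

lemma polar_cancel:
  assumes "m + 2 \<le> length js" "c \<in> \<rat>"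
  shows "(\<lambda>x. (real x + 1 + c) ^ m * (\<Prod>j\<leftarrow>js. pole 1 j x)) \<in> qspan (polar (count_list js))"
  using assms(1)
proof (induction js arbitrary: m)
  case (Cons j js)
  define w where "w = count_list (j # js)"
  have cnt: "w = (count_list js)(j := Suc (count_list js j))"
    by (auto simp: w_def)
  have step: "(\<lambda>x. (real x + 1 + c) ^ k * (\<Prod>j\<leftarrow>js. pole 1 j x) * pole 1 j x) \<in> qspan (polar w)"
    if "k + 2 \<le> length js" for k
    unfolding cnt using polar_mult[OF Cons.IH[OF that], of j] .
  have up: "f \<in> qspan (polar (count_list js)) \<Longrightarrow> f \<in> qspan (polar w)" for f
    by (erule qspan_mono[OF _ polar_mono]) (auto simp: cnt)
  have "(\<lambda>x. (real x + 1 + c) ^ m * (\<Prod>j\<leftarrow>j # js. pole 1 j x)) \<in> qspan (polar w)"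
  proof (cases "m + 2 \<le> length js")
    case True
    from step[OF True] show ?thesis by (simp add: mult_ac)
  next
    case False
    \<comment> \<open>Now \<open>m\<close> is as large as allowed: a numerator factor, if there is
      one, has to be spent on the pole at \<open>j\<close>; with \<open>m = 0\<close> there are just
      two poles.\<close>
    then have len: "length js = m + 1" using Cons.prems by simp
    show ?thesis
    proof (cases m)
      case 0
      then obtain i where js: "js = [i]" using len by (auto simp: length_Suc_conv)
      show ?thesis
      proof (cases "i = j")
        case True
        then show ?thesis using 0 js polarE[of 2 w j] pole_prod[of 1 j _ 1]
          by (simp add: cnt numeral_2_eq_2)
      next
        case False
        then show ?thesis using 0 js polar_pair[of 1 1 j i w] by (simp add: cnt)
      qed
    next
      case (Suc k)
      have e: "(real x + 1 + c) * pole 1 j x = 1 + (c - real j) * pole 1 j x" for x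
        by (simp add: pole_def divide_simps)
      have k: "k + 2 \<le> length js" using Suc len by simp
      have "(\<lambda>x. (real x + 1 + c) ^ k * (\<Prod>j\<leftarrow>js. pole 1 j x)
          + (c - real j) * ((real x + 1 + c) ^ k * (\<Prod>j\<leftarrow>js. pole 1 j x) * pole 1 j x))
          \<in> qspan (polar w)"
        by (intro qspan_add qspan_cmult up[OF Cons.IH[OF k]] step[OF k]) (use assms(2) in auto)
      then show ?thesis
      proof (rule qspan_cong)
        fix x
        have "(real x + 1 + c) ^ m * (\<Prod>j\<leftarrow>j # js. pole 1 j x)
          = (real x + 1 + c) ^ k * (\<Prod>j\<leftarrow>js. pole 1 j x) * ((real x + 1 + c) * pole 1 j x)"
          by (simp add: Suc mult_ac)
        also have "\<dots> = (real x + 1 + c) ^ k * (\<Prod>j\<leftarrow>js. pole 1 j x)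
          + (c - real j) * ((real x + 1 + c) ^ k * (\<Prod>j\<leftarrow>js. pole 1 j x) * pole 1 j x)"
          by (simp only: e) (simp add: algebra_simps)
        finally show "(real x + 1 + c) ^ m * (\<Prod>j\<leftarrow>j # js. pole 1 j x) = \<dots>" .
      qed
    qed
  qed
  then show ?case by (simp only: w_def)
qed simp

lemma polar_summable:
  assumes "f \<in> qspan (polar v)"
  shows "f summable_on UNIV"
  using assms
proof induction
  case zero
  then show ?case by simp
next
  case (step c g f)
  have "g summable_on UNIV"
    using step(2) unfolding polar_def
  proof (elim UnE CollectE exE conjE)
    fix u j assume "g = pole u j" "2 \<le> u"
    then show ?thesis by (simp add: pole_summable)
  next
    fix i j assume g: "g = (\<lambda>x. pole 1 i x - pole 1 j x)"
    have *: "(\<lambda>x. pole 1 i x - pole 1 j x) summable_on UNIV" if "i \<le> j" for i j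
    proof -
      have "zterm [] 1 i = pole 1 i" for i by (simp add: zterm_def fun_eq_iff)
      then have "((\<lambda>x. pole 1 i x - pole 1 j x) has_sum (\<Sum>l\<in>{i..<j}. pole 1 l 0)) {0..}"
        using tail_sum_zterm1[of "[]" i j, unfolded tail_sum_def, THEN spec, of 0] that by simp
      then show ?thesis using has_sum_imp_summable by simp
    qed
    show ?thesis
    proof (cases "i \<le> j")
      case True
      then show ?thesis unfolding g by (rule *)
    next
      case False
      then show ?thesis
        using summable_on_cmult_right[OF *[of j i], of "- 1"] by (simp add: g)
    qed
  qed
  then show ?case using step by (intro summable_on_add summable_on_cmult_right)
qed

section \<open>Summation of partial fractions against tails\<close>

text \<open>\<open>M\<close> stands for the hypothesis of condition (b) of an admissible representation.\<close>

locale exponent_bound =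
  fixes A :: nat and M :: bool
  assumes A_pos: "1 \<le> A"
begin

text \<open>The ceiling of \<open>x / A\<close>, that is, the least number of summation variables
  that can produce order \<open>x\<close> when each contributes at most \<open>A\<close>.\<close>

definition cl :: "nat \<Rightarrow> nat" where "cl x = (x + A - 1) div A"

lemma cl_0 [simp]: "cl 0 = 0" using A_pos by (simp add: cl_def)

lemma cl_mono: "x \<le> y \<Longrightarrow> cl x \<le> cl y" by (simp add: cl_def div_le_mono diff_le_mono)

lemma cl_add: assumes "a \<le> A" shows "cl (a + t) \<le> Suc (cl t)"
proof -
  have "cl (a + t) \<le> (t + A - 1 + A) div A"
    unfolding cl_def using assms A_pos by (intro div_le_mono) simp
  also have "\<dots> = (t + A - 1) div A + 1" using A_pos by (intro div_add_self2) simp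
  finally show ?thesis by (simp add: cl_def)
qed

lemma cl_small: "a \<le> A \<Longrightarrow> cl a \<le> 1" using cl_add[of a 0] by simp

lemma cl_ge: "x \<le> cl x * A"
proof -
  have "x + A - 1 < (cl x + 1) * A" unfolding cl_def using A_pos
    by (metis dividend_less_div_times Suc_eq_plus1 add.commute mult_Suc add_Suc_right One_nat_def less_le_trans zero_less_one Nat.add_0_right)
  then show ?thesis using A_pos by simp
qed

lemma cl_pos: "1 \<le> x \<Longrightarrow> 1 \<le> cl x"
  using cl_ge[of x] by (cases "cl x") auto

text \<open>Condition (a) on a tuple amounts to \<open>\<Sum> \<lceil>s\<^sub>j / A\<rceil> \<le> p\<close>. Here \<open>s\<close> is the reversed tuple, \<open>t\<close> the order of
  a pole that has not been summed yet, and \<open>k\<close> the number of summation variables used so far.\<close>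

definition adm :: "nat \<Rightarrow> nat \<Rightarrow> nat list \<Rightarrow> nat \<Rightarrow> bool" where
  "adm k d s t \<longleftrightarrow> (\<forall>x\<in>set s. 2 \<le> x \<and> (M \<longrightarrow> x \<le> A)) \<and> (M \<longrightarrow> t \<le> A) \<and>
     (\<Sum>x\<leftarrow>s. cl x) + cl t \<le> k \<and> length s < d"

text \<open>\<open>R\<close> is a lower bound for the positions of all poles, relevant only under \<open>M\<close>.\<close>

definition presums :: "nat \<Rightarrow> nat \<Rightarrow> nat \<Rightarrow> (nat \<Rightarrow> real) set" where
  "presums R k d = {zterm s t j | s t j. adm k d s t \<and> 2 \<le> t \<and> (M \<longrightarrow> R \<le> j)}
     \<union> {\<lambda>x. zterm s 1 i x - zterm s 1 j x | s i j. adm k d s 1 \<and> (M \<longrightarrow> R \<le> i \<and> R \<le> j)}"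

text \<open>What a summation leaves behind: tails, and poles without a decay condition, since
  telescoping releases single simple poles. These functions need not be summable until multiplied by
  the next fraction.\<close>

definition postsums :: "nat \<Rightarrow> nat \<Rightarrow> nat \<Rightarrow> (nat \<Rightarrow> real) set" where
  "postsums R k d = {\<lambda>x. ztail s (x + m) | s m. adm k d s 0 \<and> (M \<longrightarrow> R \<le> m)}
     \<union> {zterm s t j | s t j. adm k d s t \<and> 1 \<le> t \<and> (M \<longrightarrow> R \<le> j)}"

lemma presumsB: "adm k d s t \<Longrightarrow> 2 \<le> t \<Longrightarrow> (M \<Longrightarrow> R \<le> j) \<Longrightarrow> zterm s t j \<in> qspan (presums R k d)"
  unfolding presums_def by (rule qspan_base) blast

lemma presumsD: "adm k d s 1 \<Longrightarrow> (M \<Longrightarrow> R \<le> i \<and> R \<le> j) \<Longrightarrow>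
    (\<lambda>x. zterm s 1 i x - zterm s 1 j x) \<in> qspan (presums R k d)"
  unfolding presums_def by (rule qspan_base) blast

lemma postsumsZ: "adm k d s 0 \<Longrightarrow> (M \<Longrightarrow> R \<le> m) \<Longrightarrow> (\<lambda>x. ztail s (x + m)) \<in> qspan (postsums R k d)"
  unfolding postsums_def by (rule qspan_base) blast

lemma postsumsB: "adm k d s t \<Longrightarrow> 1 \<le> t \<Longrightarrow> (M \<Longrightarrow> R \<le> j) \<Longrightarrow> zterm s t j \<in> qspan (postsums R k d)"
  unfolding postsums_def by (rule qspan_base) blast

lemma presums_mono: "f \<in> qspan (presums R k d) \<Longrightarrow> d \<le> d' \<Longrightarrow> f \<in> qspan (presums R k d')"
  by (erule qspan_mono) (auto simp: presums_def adm_def, (metis less_le_trans)+)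

text \<open>Under \<open>M\<close> each new pole lies strictly below the old ones (\<open>l < j\<close>), so pole orders
  never add up and stay at most \<open>A\<close>.\<close>

lemma zterm_mult:
  assumes red0: "\<And>u l m. 1 \<le> u \<Longrightarrow> u \<le> A \<Longrightarrow> (M \<Longrightarrow> R \<le> l \<and> l < m) \<Longrightarrow>
      (\<lambda>x. pole u l x * ztail s (x + m) - zterm s u l x) \<in> qspan (presums R (Suc k) (length s))"
    and ad: "adm k d s t" and t: "1 \<le> t" and a: "1 \<le> a" "a \<le> A" and l: "M \<Longrightarrow> R \<le> l \<and> l < j"
  shows "(\<lambda>x. pole a l x * zterm s t j x) \<in> qspan (presums R (Suc k) d)"
\<comment> \<open>At equal positions the orders add, which \<open>cl_add\<close> charges to the new
  variable. Distinct positions are separated by partial fractions, which raise neither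
  order.\<close>
proof (cases "l = j")
  case True
  then have "\<not> M" using l by blast
  then have "adm (Suc k) d s (a + t)" using ad cl_add[OF a(2), of t] unfolding adm_def by simp
  then have "zterm s (a + t) j \<in> qspan (presums R (Suc k) d)"
    using \<open>\<not> M\<close> a t by (intro presumsB) auto
  then show ?thesis
    by (rule qspan_cong) (simp add: True zterm_def pole_prod[symmetric] mult_ac)
next
  case False
  define v where "v = (\<lambda>_. 0)(l := a, j := t)"
  have adu: "adm (Suc k) d s u" if "u \<le> v i" for u i
  proof -
    have "u \<le> a \<or> u \<le> t" using that by (auto simp: v_def split: if_splits)
    then show ?thesis
    proof
      assume "u \<le> a"
      then show ?thesis using a ad cl_small[of u] by (auto simp: adm_def)
    next
      assume "u \<le> t"
      then show ?thesis using ad cl_mono[of u t] by (auto simp: adm_def)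
    qed
  qed
  have R: "M \<Longrightarrow> R \<le> i" if "1 \<le> v i" for i
    using that l by (auto simp: v_def split: if_splits)
  \<comment> \<open>A pole at \<open>j\<close> fits the tail argument \<open>x + Suc j\<close>
    exactly; a pole at \<open>l\<close> does so up to an error of smaller depth, by
    \<open>red0\<close>.\<close>
  have red: "(\<lambda>x. pole u i x * ztail s (x + Suc j) - zterm s u i x) \<in> qspan (presums R (Suc k) d)"
    if "1 \<le> u" "u \<le> v i" for u i
  proof (cases "i = j")
    case True
    then show ?thesis using qspan.zero by (simp add: zterm_def)
  next
    case ij: False
    then have "i = l" "u \<le> a" using that by (auto simp: v_def split: if_splits)
    then have "(\<lambda>x. pole u i x * ztail s (x + Suc j) - zterm s u i x) \<in> qspan (presums R (Suc k) (length s))"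
      using that a l by (intro red0) auto
    then show ?thesis using ad by (elim presums_mono) (auto simp: adm_def)
  qed
  have pair: "(\<lambda>x. pole a l x * pole t j x) \<in> qspan (polar v)"
    using a t False by (intro polar_pair) (auto simp: v_def)
  have "(\<lambda>x. pole a l x * pole t j x * ztail s (x + Suc j)) \<in> qspan (presums R (Suc k) d)"
    using pair
  proof (rule qspan_mult)
    fix g assume "g \<in> polar v"
    then consider u i where "g = pole u i" "2 \<le> u" "u \<le> v i"
      | i i' where "g = (\<lambda>x. pole 1 i x - pole 1 i' x)" "1 \<le> v i" "1 \<le> v i'"
      unfolding polar_def by blast
    then show "(\<lambda>x. g x * ztail s (x + Suc j)) \<in> qspan (presums R (Suc k) d)"
    proof cases
      case 1
      have "zterm s u i \<in> qspan (presums R (Suc k) d)"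
        using 1 by (intro presumsB adu R) auto
      from qspan_add[OF red[of u i] this] show ?thesis using 1 by simp
    next
      case 2
      have "(\<lambda>x. zterm s 1 i x - zterm s 1 i' x) \<in> qspan (presums R (Suc k) d)"
        using 2 R by (intro presumsD adu) auto
      from qspan_add[OF qspan_diff[OF red[of 1 i] red[of 1 i']] this] show ?thesis
        using 2 by (simp add: algebra_simps)
    qed
  qed
  then show ?thesis by (rule qspan_cong) (simp add: zterm_def mult_ac)
qed

text \<open>The tail is moved from \<open>m\<close> to the matching argument \<open>l + 1\<close>.
  By \<open>ztail_diff\<close> this costs terms whose tail has lost its first entry, and
  \<open>zterm_mult\<close> treats these with the induction hypothesis in the role of
  \<open>red0\<close>. The error thus involves only tuples shorter than \<open>s\<close>, and after
  summation it stays below the depth reached by \<open>zterm s u l\<close>.\<close>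

lemma pole_mult_ztail:
  assumes "adm k d s 0" "1 \<le> u" "u \<le> A" "M \<Longrightarrow> R \<le> l \<and> l < m"
  shows "(\<lambda>x. pole u l x * ztail s (x + m) - zterm s u l x) \<in> qspan (presums R (Suc k) (length s))"
  using assms
proof (induction s arbitrary: d u l m)
  case Nil
  then show ?case using qspan.zero by (simp add: zterm_def)
next
  case (Cons t s)
  have ad: "adm k (length (t # s)) s t" using Cons.prems by (auto simp: adm_def)
  have ad0: "adm k (Suc (length s)) s 0" using Cons.prems by (auto simp: adm_def)
  have s2: "\<forall>x\<in>set s. 2 \<le> x" "2 \<le> t" using Cons.prems by (auto simp: adm_def)
  have BB: "(\<lambda>x. pole u l x * zterm s t i x) \<in> qspan (presums R (Suc k) (length (t # s)))"
    if "M \<Longrightarrow> R \<le> l \<and> l < i" for i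
    by (rule zterm_mult[OF Cons.IH[OF ad0] ad]) (use that Cons.prems s2 in auto)
  show ?case
  proof (cases "Suc l \<le> m")
    case True
    have "(\<lambda>x. - 1 * (\<Sum>i\<in>{Suc l..<m}. pole u l x * zterm s t i x)) \<in> qspan (presums R (Suc k) (length (t # s)))"
      by (intro qspan_cmult qspan_sum BB) (use Cons.prems in auto)
    then show ?thesis
    proof (rule qspan_cong)
      fix x
      have "ztail (t # s) (x + m) = ztail (t # s) (x + Suc l) - (\<Sum>i\<in>{Suc l..<m}. zterm s t i x)"
        using ztail_diff[OF s2 True, of x] by simp
      then show "pole u l x * ztail (t # s) (x + m) - zterm (t # s) u l x = - 1 * (\<Sum>i\<in>{Suc l..<m}. pole u l x * zterm s t i x)"
        by (simp add: zterm_def[of "t # s"] right_diff_distrib sum_distrib_left sum_negf)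
    qed
  next
    case False
    \<comment> \<open>Here \<open>m <= l\<close>, which the separation of positions excludes under
      \<open>M\<close>.\<close>
    then have nM: "\<not> M" using Cons.prems by auto
    have "(\<lambda>x. \<Sum>i\<in>{m..<Suc l}. pole u l x * zterm s t i x) \<in> qspan (presums R (Suc k) (length (t # s)))"
      by (intro qspan_sum BB) (use nM in auto)
    then show ?thesis
    proof (rule qspan_cong)
      fix x
      have "ztail (t # s) (x + m) = ztail (t # s) (x + Suc l) + (\<Sum>i\<in>{m..<Suc l}. zterm s t i x)"
        using ztail_diff[OF s2, of m "Suc l" x] False by simp
      then show "pole u l x * ztail (t # s) (x + m) - zterm (t # s) u l x = (\<Sum>i\<in>{m..<Suc l}. pole u l x * zterm s t i x)"
        by (simp add: zterm_def[of "t # s"] distrib_left sum_distrib_left)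
    qed
  qed
qed

lemma zterm1_diff_tail_sum:
  assumes "adm k d s 1" "M \<Longrightarrow> R \<le> i \<and> R \<le> j"
  shows "\<exists>F\<in>qspan (postsums R k d). tail_sum (\<lambda>x. zterm s 1 i x - zterm s 1 j x) F"
proof -
  have *: "\<exists>F\<in>qspan (postsums R k d). tail_sum (\<lambda>x. zterm s 1 i x - zterm s 1 j x) F"
    if "i \<le> j" "M \<Longrightarrow> R \<le> i" for i j
  proof -
    have "(\<lambda>y. \<Sum>l\<in>{i..<j}. zterm s 1 l y) \<in> qspan (postsums R k d)"
      by (intro qspan_sum postsumsB assms(1)) (use that(2) in \<open>auto intro: order_trans\<close>)
    then show ?thesis using tail_sum_zterm1[OF _ that(1), of s] assms(1) by (auto simp: adm_def)
  qed
  show ?thesis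
  proof (cases "i \<le> j")
    case True
    then show ?thesis using * assms by blast
  next
    case False
    then obtain F where F: "F \<in> qspan (postsums R k d)" "tail_sum (\<lambda>x. zterm s 1 j x - zterm s 1 i x) F"
      using *[of j i] assms by auto
    have "(\<lambda>x. - 1 * F x) \<in> qspan (postsums R k d)" by (intro qspan_cmult F) auto
    moreover have "tail_sum (\<lambda>x. zterm s 1 i x - zterm s 1 j x) (\<lambda>x. - 1 * F x)"
      using tail_sum_cmult[OF F(2), of "- 1"] by simp
    ultimately show ?thesis by blast
  qed
qed

text \<open>The pending order \<open>t\<close> turns into an entry: the sum of ceilings is unchanged
  and the depth bound rises by one. Telescoping generators create no entry.\<close>

lemma presums_tail_sum:
  assumes "f \<in> qspan (presums R k d)"
  shows "\<exists>F\<in>qspan (postsums R k (Suc d)). tail_sum f F"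
  using assms
proof (rule qspan_tail_sum)
  fix g assume "g \<in> presums R k d"
  then consider s t j where "g = zterm s t j" "adm k d s t" "2 \<le> t" "M \<longrightarrow> R \<le> j"
    | s i j where "g = (\<lambda>x. zterm s 1 i x - zterm s 1 j x)" "adm k d s 1" "M \<longrightarrow> R \<le> i \<and> R \<le> j"
    unfolding presums_def by blast
  then show "\<exists>F\<in>qspan (postsums R k (Suc d)). tail_sum g F"
  proof cases
    case 1
    then have "adm k (Suc d) (t # s) 0" "\<forall>x\<in>set s. 2 \<le> x" by (auto simp: adm_def)
    then show ?thesis using postsumsZ[of k "Suc d" "t # s" R j] tail_sum_zterm[of s t j] 1 by blast
  next
    case 2
    then have "adm k (Suc d) s 1" by (simp add: adm_def)
    then show ?thesis using zterm1_diff_tail_sum[of k "Suc d" s R i j] 2 by blast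
  qed
qed

text \<open>\<open>W u l\<close> is a model of \<open>pole u l\<close> times \<open>g\<close> modulo
  the span \<open>H\<close>. Models for simple poles are compared in pairs only, since
  \<open>polar\<close> contains them only as differences.\<close>

lemma polar_mult_gen:
  assumes f: "f \<in> qspan (polar v)" and v: "\<And>j. v j \<le> A" "\<And>j. n < j \<Longrightarrow> v j = 0"
    and red: "\<And>u l. 1 \<le> u \<Longrightarrow> u \<le> A \<Longrightarrow> r \<le> l \<Longrightarrow> l \<le> r + n \<Longrightarrow>
      (\<lambda>x. pole u l x * g x - W u l x) \<in> qspan H"
    and W2: "\<And>u l. 2 \<le> u \<Longrightarrow> u \<le> A \<Longrightarrow> r \<le> l \<Longrightarrow> W u l \<in> qspan H"
    and W1: "\<And>i j. r \<le> i \<Longrightarrow> r \<le> j \<Longrightarrow> (\<lambda>x. W 1 i x - W 1 j x) \<in> qspan H"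
  shows "(\<lambda>x. f (x + r) * g x) \<in> qspan H"
proof -
  have gen: "(\<lambda>x. h (x + r) * g x) \<in> qspan H" if hp: "h \<in> polar v" for h
  proof -
    have n: "j \<le> n" if "1 \<le> v j" for j
      using v(2)[of j] that by (cases "n < j") auto
    consider u j where "h = pole u j" "2 \<le> u" "u \<le> v j"
      | i j where "h = (\<lambda>x. pole 1 i x - pole 1 j x)" "1 \<le> v i" "1 \<le> v j"
      using hp unfolding polar_def by blast
    then show ?thesis
    proof cases
      case 1
      then have "j \<le> n" "u \<le> A" using n[of j] v(1)[of j] by auto
      then have "(\<lambda>x. pole u (r + j) x * g x - W u (r + j) x + W u (r + j) x) \<in> qspan H"
        using 1 by (intro qspan_add red W2) auto
      then show ?thesis by (simp add: 1 pole_shift)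
    next
      case 2
      then have "i \<le> n" "j \<le> n" using n by auto
      then have "(\<lambda>x. (pole 1 (r + i) x * g x - W 1 (r + i) x) - (pole 1 (r + j) x * g x - W 1 (r + j) x)
          + (W 1 (r + i) x - W 1 (r + j) x)) \<in> qspan H"
        using A_pos by (intro qspan_add qspan_diff red W1) auto
      then show ?thesis by (simp add: 2 pole_shift algebra_simps)
    qed
  qed
  show ?thesis
    using f
  proof induction
    case zero
    then show ?case using qspan.zero by simp
  next
    case (step c h f)
    then show ?case
      using qspan_add[OF qspan_cmult[OF gen[of h], of c] step.IH] by (simp add: algebra_simps)
  qed
qed

text \<open>Taking in one more variable raises the budget \<open>k\<close> but not the depth bound
  \<open>d\<close>, which moves only at summation. Under \<open>M\<close> the new positions
  \<open>r\<close> to \<open>r + n\<close> lie below all old ones.\<close>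

lemma polar_mult_postsums:
  assumes f: "f \<in> qspan (polar v)" and v: "\<And>j. v j \<le> A" "\<And>j. n < j \<Longrightarrow> v j = 0"
    and G: "G \<in> qspan (postsums R k d)" and R: "M \<Longrightarrow> r + n < R"
  shows "(\<lambda>x. f (x + r) * G x) \<in> qspan (presums r (Suc k) d)"
proof -
  have "(\<lambda>x. G x * f (x + r)) \<in> qspan (presums r (Suc k) d)"
    using G
  proof (rule qspan_mult)
    fix g assume "g \<in> postsums R k d"
    then consider s m where "g = (\<lambda>x. ztail s (x + m))" "adm k d s 0" "M \<longrightarrow> R \<le> m"
      | s t j where "g = zterm s t j" "adm k d s t" "1 \<le> t" "M \<longrightarrow> R \<le> j"
      unfolding postsums_def by blast
    then have "(\<lambda>x. f (x + r) * g x) \<in> qspan (presums r (Suc k) d)"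
    proof cases
      case 1
      have ad: "adm (Suc k) d s u" if "u \<le> A" for u
        using 1 that cl_small[of u] by (auto simp: adm_def)
      show ?thesis
      proof (rule polar_mult_gen[OF f v, where W = "zterm s"])
        fix u l assume "1 \<le> u" "u \<le> A" "r \<le> l" "l \<le> r + n"
        then have "(\<lambda>x. pole u l x * g x - zterm s u l x) \<in> qspan (presums r (Suc k) (length s))"
          unfolding 1 using 1 R by (intro pole_mult_ztail[of k d]) auto
        then show "(\<lambda>x. pole u l x * g x - zterm s u l x) \<in> qspan (presums r (Suc k) d)"
          using 1 by (elim presums_mono) (auto simp: adm_def)
      next
        fix u l assume "2 \<le> u" "u \<le> A" "r \<le> l"
        then show "zterm s u l \<in> qspan (presums r (Suc k) d)" by (intro presumsB ad)
      next
        fix i j assume "r \<le> i" "r \<le> j"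
        then show "(\<lambda>x. zterm s 1 i x - zterm s 1 j x) \<in> qspan (presums r (Suc k) d)"
          using A_pos by (intro presumsD ad) auto
      qed
    next
      case 2
      have ad0: "adm k d s 0" using 2 by (auto simp: adm_def)
      show ?thesis
      \<comment> \<open>A product with an existing pole lies in the span by itself, so the model is
        0.\<close>
      proof (rule polar_mult_gen[OF f v, where W = "\<lambda>_ _ _. 0"])
        fix u l assume "1 \<le> u" "u \<le> A" "r \<le> l" "l \<le> r + n"
        then have "(\<lambda>x. pole u l x * g x) \<in> qspan (presums r (Suc k) d)"
          unfolding 2 using 2 R by (intro zterm_mult[OF pole_mult_ztail[OF ad0]]) auto
        then show "(\<lambda>x. pole u l x * g x - 0) \<in> qspan (presums r (Suc k) d)" by simp
      qed (auto intro: qspan.zero)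
    qed
    then show "(\<lambda>x. g x * f (x + r)) \<in> qspan (presums r (Suc k) d)" by (simp add: mult.commute)
  qed
  then show ?thesis by (simp add: mult.commute)
qed

text \<open>\<open>D u\<close> is the total coefficient of the poles of order \<open>u\<close> of \<open>f\<close>: it does not depend on the
  shift \<open>r\<close> and determines the part of maximal depth.\<close>

definition leading :: "nat \<Rightarrow> (nat \<Rightarrow> real) \<Rightarrow> (nat \<Rightarrow> real) \<Rightarrow> bool" where
  "leading n f D \<longleftrightarrow> (\<forall>r s m k. adm k (Suc (length s)) s 0 \<longrightarrow> (M \<longrightarrow> r + n < m) \<longrightarrow>
     (\<exists>F\<in>qspan (postsums r (Suc k) (Suc (length s))).
        tail_sum (\<lambda>x. f (x + r) * ztail s (x + m))
          (\<lambda>y. (\<Sum>u=2..A. D u * ztail (u # s) (y + r)) + F y)))"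

lemma leading_zero: "leading n (\<lambda>_. 0) (\<lambda>_. 0)"
  unfolding leading_def using qspan.zero tail_sum_zero by fastforce

lemma leading_lincomb:
  assumes "leading n f D" "leading n g D'" "c \<in> \<rat>"
  shows "leading n (\<lambda>x. c * f x + g x) (\<lambda>u. c * D u + D' u)"
  unfolding leading_def
proof (intro allI impI)
  fix r s m k assume a: "adm k (Suc (length s)) s 0" "M \<longrightarrow> r + n < m"
  let ?Y = "qspan (postsums r (Suc k) (Suc (length s)))"
  obtain F G where
    F: "F \<in> ?Y" "tail_sum (\<lambda>x. f (x + r) * ztail s (x + m)) (\<lambda>y. (\<Sum>u=2..A. D u * ztail (u # s) (y + r)) + F y)"
    and G: "G \<in> ?Y" "tail_sum (\<lambda>x. g (x + r) * ztail s (x + m)) (\<lambda>y. (\<Sum>u=2..A. D' u * ztail (u # s) (y + r)) + G y)"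
    using assms a unfolding leading_def by meson
  have 1: "(\<lambda>y. c * F y + G y) \<in> ?Y" by (intro qspan_add qspan_cmult F G assms)
  have 2: "tail_sum (\<lambda>x. (c * f (x + r) + g (x + r)) * ztail s (x + m))
      (\<lambda>y. (\<Sum>u=2..A. (c * D u + D' u) * ztail (u # s) (y + r)) + (c * F y + G y))"
    using tail_sum_lincomb[OF F(2) G(2), of c]
    by (simp add: algebra_simps sum.distrib sum_distrib_left)
  show "\<exists>F\<in>?Y. tail_sum (\<lambda>x. (c * f (x + r) + g (x + r)) * ztail s (x + m))
      (\<lambda>y. (\<Sum>u=2..A. (c * D u + D' u) * ztail (u # s) (y + r)) + F y)" by (rule bexI[OF _ 1]) (rule 2)
qed

text \<open>Summation produces the tail at \<open>y + r + j\<close>; moving it to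
  \<open>y + r\<close> costs only terms with tail \<open>s\<close>, which count as error. Hence the
  coefficient is insensitive to the position \<open>j\<close> and to the shift
  \<open>r\<close>.\<close>

lemma leading_pole:
  assumes u: "2 \<le> u" "u \<le> A" and "j \<le> n"
  shows "leading n (pole u j) (\<lambda>t. if t = u then 1 else 0)"
  unfolding leading_def
proof (intro allI impI)
  fix r s m k assume a: "adm k (Suc (length s)) s 0" "M \<longrightarrow> r + n < m"
  let ?Y = "qspan (postsums r (Suc k) (Suc (length s)))"
  have s2: "\<forall>x\<in>set s. 2 \<le> x" using a by (auto simp: adm_def)
  have ad: "adm (Suc k) (Suc (length s)) s u" using a u cl_small[of u] by (auto simp: adm_def)
  have "(\<lambda>x. pole u (r + j) x * ztail s (x + m) - zterm s u (r + j) x) \<in> qspan (presums r (Suc k) (length s))"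
    using a assms by (intro pole_mult_ztail) auto
  then obtain F where F: "F \<in> ?Y" "tail_sum (\<lambda>x. pole u (r + j) x * ztail s (x + m) - zterm s u (r + j) x) F"
    using presums_tail_sum by blast
  have 1: "(\<lambda>y. F y - (\<Sum>i\<in>{r..<r + j}. zterm s u i y)) \<in> ?Y"
    by (intro qspan_diff F qspan_sum postsumsB ad) (use u in auto)
  have 2: "tail_sum (\<lambda>x. pole u j (x + r) * ztail s (x + m))
     (\<lambda>y. (\<Sum>t=2..A. (if t = u then 1 else 0) * ztail (t # s) (y + r)) + (F y - (\<Sum>i\<in>{r..<r + j}. zterm s u i y)))"
  proof -
    have "(\<Sum>t=2..A. (if t = u then 1 else 0) * ztail (t # s) (y + r)) = ztail (u # s) (y + r)" for y
      using u by (simp add: if_distrib[of "\<lambda>c. c * _"] cong: if_cong)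
    moreover have "ztail (u # s) (y + (r + j)) = ztail (u # s) (y + r) - (\<Sum>i\<in>{r..<r + j}. zterm s u i y)" for y
      using ztail_diff[OF s2 u(1), of r "r + j" y] by simp
    ultimately have *: "(\<lambda>y. F y + ztail (u # s) (y + (r + j))) =
        (\<lambda>y. (\<Sum>t=2..A. (if t = u then 1 else 0) * ztail (t # s) (y + r)) + (F y - (\<Sum>i\<in>{r..<r + j}. zterm s u i y)))"
      by (simp add: fun_eq_iff)
    have "tail_sum (\<lambda>x. pole u j (x + r) * ztail s (x + m)) (\<lambda>y. F y + ztail (u # s) (y + (r + j)))"
      using tail_sum_add[OF F(2) tail_sum_zterm[OF s2 u(1), of "r + j"]] by (simp add: pole_shift)
    then show ?thesis by (simp only: *)
  qed
  show "\<exists>F\<in>?Y. tail_sum (\<lambda>x. pole u j (x + r) * ztail s (x + m))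
     (\<lambda>y. (\<Sum>t=2..A. (if t = u then 1 else 0) * ztail (t # s) (y + r)) + F y)"
    by (rule bexI[OF _ 1]) (rule 2)
qed

text \<open>A telescoping sum creates no new entry, so a difference of simple poles contributes
  nothing in maximal depth.\<close>

lemma leading_pole1_diff:
  assumes "i \<le> n" "j \<le> n"
  shows "leading n (\<lambda>x. pole 1 i x - pole 1 j x) (\<lambda>t. 0)"
  unfolding leading_def
proof (intro allI impI)
  fix r s m k assume a: "adm k (Suc (length s)) s 0" "M \<longrightarrow> r + n < m"
  let ?Y = "qspan (postsums r (Suc k) (Suc (length s)))"
  have ad: "adm (Suc k) (Suc (length s)) s 1"
    using a A_pos cl_small[of 1] by (auto simp: adm_def)
  have "(\<lambda>x. (pole 1 (r + i) x * ztail s (x + m) - zterm s 1 (r + i) x) - (pole 1 (r + j) x * ztail s (x + m) - zterm s 1 (r + j) x))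
     \<in> qspan (presums r (Suc k) (length s))"
    using a assms A_pos by (intro qspan_diff pole_mult_ztail) auto
  then obtain F where F: "F \<in> ?Y" "tail_sum (\<lambda>x. (pole 1 (r + i) x * ztail s (x + m) - zterm s 1 (r + i) x)
      - (pole 1 (r + j) x * ztail s (x + m) - zterm s 1 (r + j) x)) F"
    using presums_tail_sum by blast
  obtain G where G: "G \<in> ?Y" "tail_sum (\<lambda>x. zterm s 1 (r + i) x - zterm s 1 (r + j) x) G"
    using zterm1_diff_tail_sum[OF ad, of r "r + i" "r + j"] by auto
  have "(\<lambda>y. F y + G y) \<in> ?Y" by (intro qspan_add F G)
  moreover have "tail_sum (\<lambda>x. (pole 1 i (x + r) - pole 1 j (x + r)) * ztail s (x + m)) (\<lambda>y. F y + G y)"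
    using tail_sum_add[OF F(2) G(2)] by (simp add: pole_shift algebra_simps)
  ultimately show "\<exists>F\<in>?Y. tail_sum (\<lambda>x. (pole 1 i (x + r) - pole 1 j (x + r)) * ztail s (x + m))
     (\<lambda>y. (\<Sum>u=2..A. 0 * ztail (u # s) (y + r)) + F y)" by auto
qed

lemma leading_exists:
  assumes f: "f \<in> qspan (polar v)" and v: "\<And>j. v j \<le> A" "\<And>j. n < j \<Longrightarrow> v j = 0"
  shows "\<exists>D. (\<forall>u. D u \<in> \<rat>) \<and> leading n f D"
  using f
proof induction
  case zero
  then show ?case using leading_zero by (intro exI[of _ "\<lambda>_. 0"]) auto
next
  case (step c g f)
  then obtain D where D: "\<forall>u. D u \<in> \<rat>" "leading n f D" by blast
  have n: "j \<le> n" if "1 \<le> v j" for j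
    using v(2)[of j] that by (cases "n < j") auto
  consider u j where "g = pole u j" "2 \<le> u" "u \<le> v j"
    | i j where "g = (\<lambda>x. pole 1 i x - pole 1 j x)" "1 \<le> v i" "1 \<le> v j"
    using \<open>g \<in> polar v\<close> unfolding polar_def by blast
  then have "\<exists>D'. (\<forall>u. D' u \<in> \<rat>) \<and> leading n g D'"
  proof cases
    case 1
    then show ?thesis
      using n[of j] v(1)[of j] leading_pole[of u j n] by (intro exI[of _ "\<lambda>t. if t = u then 1 else 0"]) auto
  next
    case 2
    then show ?thesis
      using n leading_pole1_diff[of i n j] by (intro exI[of _ "\<lambda>t. 0"]) auto
  qed
  then obtain D' where D': "\<forall>u. D' u \<in> \<rat>" "leading n g D'" by blast
  have "leading n (\<lambda>x. c * g x + f x) (\<lambda>u. c * D' u + D u)"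
    by (rule leading_lincomb[OF D'(2) D(2) step(1)])
  then show ?case using D D' step(1) by (intro exI[of _ "\<lambda>u. c * D' u + D u"]) auto
qed

section \<open>Expansion of the full nested sum\<close>

definition tuples :: "nat \<Rightarrow> nat list set" where
  "tuples i = {t. length t = i \<and> set t \<subseteq> {2..A}}"

lemma finite_tuples [simp]: "finite (tuples i)"
  using finite_lists_length_eq[of "{2..A}" i] by (simp add: tuples_def conj_commute)

lemma sum_tuples_Suc: "(\<Sum>t\<in>tuples (Suc i). F t) = (\<Sum>t\<in>tuples i. \<Sum>u=2..A. F (t @ [u]))"
proof -
  have *: "\<exists>t u. l = t @ [u] \<and> t \<in> tuples i \<and> u \<in> {2..A}" if "l \<in> tuples (Suc i)" for l
    using that by (cases l rule: rev_cases) (auto simp: tuples_def)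
  have snoc: "t @ [u] \<in> tuples (Suc i)" if "t \<in> tuples i" "2 \<le> u" "u \<le> A" for t u
    using that by (auto simp: tuples_def)
  have "(\<Sum>t\<in>tuples (Suc i). F t) = (\<Sum>(t, u)\<in>tuples i \<times> {2..A}. F (t @ [u]))"
    by (rule sum.reindex_bij_witness[of _ "\<lambda>(t, u). t @ [u]" "\<lambda>t. (butlast t, last t)"])
      (auto dest!: * intro: snoc)
  then show ?thesis by (simp add: sum.cartesian_product)
qed

lemma cl_tuple: "set t \<subseteq> {2..A} \<Longrightarrow> (\<Sum>x\<leftarrow>t. cl x) = length t"
proof (induction t)
  case (Cons x t)
  then show ?case using cl_small[of x] cl_pos[of x] by simp
qed simp

lemma adm_tuple: "t \<in> tuples i \<Longrightarrow> adm i (Suc i) (rev t) 0"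
  using cl_tuple[of t] by (auto simp: tuples_def adm_def rev_map[symmetric] subset_iff)

text \<open>The depth \<open>i\<close> part is kept explicit, as it has to inherit the symmetry;
  everything else is absorbed in a span of depth below \<open>i\<close>. \<open>R i\<close> bounds
  the positions from below after \<open>i\<close> summations. Nothing has been summed for
  \<open>i = 0\<close>, and \<open>r 0 + n + 1\<close> is the least value above the first positions
  \<open>r 0\<close> to \<open>r 0 + n\<close>.\<close>

lemma nested_sum_expansion:
  assumes f: "\<And>j. j < p \<Longrightarrow> f j \<in> qspan (polar v)"
    and v: "\<And>j. v j \<le> A" "\<And>j. n < j \<Longrightarrow> v j = 0"
    and lead: "\<And>j. j < p \<Longrightarrow> leading n (f j) (D j)"
    and D: "\<And>j u. j < p \<Longrightarrow> D j u \<in> \<rat>"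
    and sep: "\<And>j. M \<Longrightarrow> Suc j < p \<Longrightarrow> r (Suc j) + n + 1 \<le> r j"
  defines "R \<equiv> (\<lambda>i. case i of 0 \<Rightarrow> r 0 + n + 1 | Suc i \<Rightarrow> r i)"
  assumes "i \<le> p"
  shows "\<exists>G\<in>qspan (postsums (R i) i i). \<forall>y. nested_sum 0 (rev (map (\<lambda>j x. f j (x + r j)) [0..<i])) y =
    (\<Sum>t\<in>tuples i. (\<Prod>j<i. D j (t ! j)) * ztail (rev t) (y + R i)) + G y"
  using \<open>i \<le> p\<close>
proof (induction i)
  case 0
  have "tuples 0 = {[]}" by (auto simp: tuples_def)
  then show ?case by (intro bexI[of _ "\<lambda>_. 0"]) (auto intro: qspan.zero)
next
  case (Suc i)
  let ?fs = "rev (map (\<lambda>j x. f j (x + r j)) [0..<i])"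
  let ?d = "\<lambda>t. \<Prod>j<i. D j (t ! j)"
  let ?Y = "qspan (postsums (R (Suc i)) (Suc i) (Suc i))"
  obtain G where G: "G \<in> qspan (postsums (R i) i i)"
    "\<And>y. nested_sum 0 ?fs y = (\<Sum>t\<in>tuples i. ?d t * ztail (rev t) (y + R i)) + G y"
    using Suc by auto
  have RS: "R (Suc i) = r i" by (simp add: R_def)
  have R: "M \<Longrightarrow> r i + n < R i"
    using sep[of "i - 1"] Suc.prems by (cases i) (auto simp: R_def)
  have i: "i < p" using Suc.prems by simp
  \<comment> \<open>The old error has depth below \<open>i\<close>, hence below \<open>Suc i\<close>
    after one more summation.\<close>
  obtain F0 where F0: "F0 \<in> ?Y" "tail_sum (\<lambda>x. f i (x + r i) * G x) F0"
    using presums_tail_sum[OF polar_mult_postsums[OF f[OF i] v G(1) R]] RS by auto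
  have "\<exists>F\<in>?Y. tail_sum (\<lambda>x. f i (x + r i) * ztail (rev t) (x + R i))
          (\<lambda>y. (\<Sum>u=2..A. D i u * ztail (u # rev t) (y + r i)) + F y)" if "t \<in> tuples i" for t
  proof -
    have "length (rev t) = i" using that by (simp add: tuples_def)
    then show ?thesis
      using lead[OF i, unfolded leading_def, rule_format, of i "rev t" "r i" "R i"] adm_tuple[OF that] R RS
      by simp
  qed
  then have "\<forall>t\<in>tuples i. \<exists>F. F \<in> ?Y \<and> tail_sum (\<lambda>x. f i (x + r i) * ztail (rev t) (x + R i))
          (\<lambda>y. (\<Sum>u=2..A. D i u * ztail (u # rev t) (y + r i)) + F y)" by blast
  from bchoice[OF this] obtain F where "\<forall>t\<in>tuples i. F t \<in> ?Y \<and>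
      tail_sum (\<lambda>x. f i (x + r i) * ztail (rev t) (x + R i))
          (\<lambda>y. (\<Sum>u=2..A. D i u * ztail (u # rev t) (y + r i)) + F t y)" ..
  then have F: "\<And>t. t \<in> tuples i \<Longrightarrow> F t \<in> ?Y"
    "\<And>t. t \<in> tuples i \<Longrightarrow> tail_sum (\<lambda>x. f i (x + r i) * ztail (rev t) (x + R i))
          (\<lambda>y. (\<Sum>u=2..A. D i u * ztail (u # rev t) (y + r i)) + F t y)"
    by auto
  have d: "?d t \<in> \<rat>" for t using D i by (intro Rats_prod) auto
  have Y: "(\<lambda>y. (\<Sum>t\<in>tuples i. ?d t * F t y) + F0 y) \<in> ?Y"
    by (intro qspan_add qspan_sum qspan_cmult F F0 d)
  have "tail_sum (\<lambda>x. (\<Sum>t\<in>tuples i. ?d t * (f i (x + r i) * ztail (rev t) (x + R i))) + f i (x + r i) * G x)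
      (\<lambda>y. (\<Sum>t\<in>tuples i. ?d t * ((\<Sum>u=2..A. D i u * ztail (u # rev t) (y + r i)) + F t y)) + F0 y)"
    by (intro tail_sum_add tail_sum_sum tail_sum_cmult F F0)
  moreover have "(\<Sum>t\<in>tuples i. ?d t * (f i (x + r i) * ztail (rev t) (x + R i))) + f i (x + r i) * G x
      = f i (x + r i) * nested_sum 0 ?fs (x + 0)" for x
    by (simp add: G(2) distrib_left sum_distrib_left mult_ac)
  ultimately have "((\<lambda>x. f i (x + r i) * nested_sum 0 ?fs (x + 0)) has_sum
      (\<Sum>t\<in>tuples i. ?d t * ((\<Sum>u=2..A. D i u * ztail (u # rev t) (y + r i)) + F t y)) + F0 y) {y..}" for y
    unfolding tail_sum_def by simp
  then have main: "nested_sum 0 (rev (map (\<lambda>j x. f j (x + r j)) [0..<Suc i])) y =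
      (\<Sum>t\<in>tuples i. ?d t * ((\<Sum>u=2..A. D i u * ztail (u # rev t) (y + r i)) + F t y)) + F0 y" for y
    by (simp add: infsumI)
  have split: "(\<Sum>t\<in>tuples i. ?d t * ((\<Sum>u=2..A. D i u * ztail (u # rev t) (y + r i)) + F t y)) =
      (\<Sum>t\<in>tuples i. \<Sum>u=2..A. ?d t * D i u * ztail (u # rev t) (y + r i)) + (\<Sum>t\<in>tuples i. ?d t * F t y)" for y
    by (simp only: distrib_left sum.distrib sum_distrib_left mult.assoc)
  have top: "(\<Sum>t\<in>tuples i. \<Sum>u=2..A. ?d t * D i u * ztail (u # rev t) (y + r i)) =
      (\<Sum>t\<in>tuples (Suc i). (\<Prod>j<Suc i. D j (t ! j)) * ztail (rev t) (y + R (Suc i)))" for y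
    unfolding sum_tuples_Suc
  proof (intro sum.cong refl)
    fix t u assume "t \<in> tuples i"
    then have len: "length t = i" by (simp add: tuples_def)
    then have "(\<Prod>j<i. D j ((t @ [u]) ! j)) = ?d t" by (intro prod.cong) (auto simp: nth_append)
    then show "?d t * D i u * ztail (u # rev t) (y + r i) =
        (\<Prod>j<Suc i. D j ((t @ [u]) ! j)) * ztail (rev (t @ [u])) (y + R (Suc i))"
      using nth_append_length[of t u] len by (simp add: RS)
  qed
  show ?case
    by (rule bexI[OF _ Y]) (simp only: main split top add.assoc simp_thms)
qed

section \<open>From functions of the lower bound to numbers\<close>

definition finals :: "nat \<Rightarrow> nat \<Rightarrow> (nat \<Rightarrow> real) set" where
  "finals k d = {\<lambda>_. ztail s 0 | s. adm k d s 0}"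

lemma finals_mono: "f \<in> qspan (finals k d) \<Longrightarrow> d \<le> d' \<Longrightarrow> f \<in> qspan (finals k d')"
  by (erule qspan_mono) (auto simp: finals_def adm_def intro: less_le_trans)

lemma pole_Rats: "pole t j x \<in> \<rat>"
  by (simp add: pole_def)

text \<open>Completing a tail to the full sum costs finitely many rational multiples of shorter
  tails, so the coefficient in full depth is unaffected.\<close>

lemma ztail_final:
  assumes "adm k d s 0"
  shows "(\<lambda>_. ztail s m - ztail s 0) \<in> qspan (finals k (length s))" "(\<lambda>_. ztail s m) \<in> qspan (finals k d)"
proof -
  have "(\<lambda>_. ztail s m - ztail s 0) \<in> qspan (finals k (length s)) \<and> (\<lambda>_. ztail s m) \<in> qspan (finals k d)"
    using assms
  proof (induction s arbitrary: m d)
    case Nil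
    have "(\<lambda>_. ztail [] 0) \<in> qspan (finals k d)"
      using Nil unfolding finals_def by (intro qspan_base) blast
    then show ?case using qspan.zero by simp
  next
    case (Cons t s)
    have s2: "\<forall>x\<in>set s. 2 \<le> x" "2 \<le> t" using Cons.prems by (auto simp: adm_def)
    have "adm k (length (t # s)) s 0" using Cons.prems by (auto simp: adm_def)
    then have "(\<lambda>_. - 1 * (\<Sum>i\<in>{0..<m}. pole t i 0 * ztail s (i + 1))) \<in> qspan (finals k (length (t # s)))"
      using Cons.IH by (intro qspan_cmult qspan_sum pole_Rats) auto
    moreover have "ztail (t # s) m - ztail (t # s) 0 = - 1 * (\<Sum>i\<in>{0..<m}. pole t i 0 * ztail s (i + 1))"
      using ztail_diff[OF s2, of 0 m 0] by (simp add: zterm_def)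
    ultimately have 1: "(\<lambda>_. ztail (t # s) m - ztail (t # s) 0) \<in> qspan (finals k (length (t # s)))" by simp
    have "(\<lambda>_. ztail (t # s) 0) \<in> qspan (finals k d)"
      using Cons.prems unfolding finals_def by (intro qspan_base) blast
    moreover have "(\<lambda>_. ztail (t # s) m - ztail (t # s) 0) \<in> qspan (finals k d)"
      using finals_mono[OF 1] Cons.prems by (auto simp: adm_def)
    ultimately have "(\<lambda>_. (ztail (t # s) m - ztail (t # s) 0) + ztail (t # s) 0) \<in> qspan (finals k d)"
      by (intro qspan_add)
    with 1 show ?case by simp
  qed
  then show "(\<lambda>_. ztail s m - ztail s 0) \<in> qspan (finals k (length s))" "(\<lambda>_. ztail s m) \<in> qspan (finals k d)"
    by auto
qed

text \<open>At \<open>x = 0\<close> a pole is just a rational number: an order that was never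
  summed, in particular order 1, leaves no entry behind.\<close>

lemma postsums_final:
  assumes "G \<in> qspan (postsums R k d)"
  shows "(\<lambda>_. G 0) \<in> qspan (finals k d)"
  using assms
proof induction
  case zero
  then show ?case by (rule qspan.zero)
next
  case (step c g f)
  consider s m where "g = (\<lambda>x. ztail s (x + m))" "adm k d s 0"
      | s t j where "g = zterm s t j" "adm k d s t"
    using step(2) unfolding postsums_def by blast
  then have "(\<lambda>_. g 0) \<in> qspan (finals k d)"
  proof cases
    case 1
    then show ?thesis using ztail_final(2)[of k d s m] by simp
  next
    case 2
    then have "adm k d s 0" by (simp add: adm_def)
    then have "(\<lambda>_. pole t j 0 * ztail s (j + 1)) \<in> qspan (finals k d)"
      by (intro qspan_cmult ztail_final pole_Rats)
    then show ?thesis using 2 by (simp add: zterm_def)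
  qed
  then show ?case by (intro qspan_add qspan_cmult step)
qed

lemma finals_coefficients:
  assumes "f \<in> qspan (finals k d)"
  shows "\<exists>T c. finite T \<and> (\<forall>s\<in>T. adm k d (rev s) 0) \<and> (\<forall>s. c s \<in> \<rat> \<and> (s \<notin> T \<longrightarrow> c s = 0)) \<and>
    (\<forall>x. f x = (\<Sum>s\<in>T. c s * mzv s))"
  using assms
proof induction
  case zero
  show ?case by (intro exI[of _ "{}"] exI[of _ "\<lambda>_. 0"]) auto
next
  case (step a g f)
  from step(2) obtain s0 where s0: "g = (\<lambda>_. ztail s0 0)" "adm k d s0 0" by (auto simp: finals_def)
  from step.IH obtain T c where T: "finite T" "\<forall>s\<in>T. adm k d (rev s) 0"
    "\<forall>s. c s \<in> \<rat> \<and> (s \<notin> T \<longrightarrow> c s = 0)" "\<And>x. f x = (\<Sum>s\<in>T. c s * mzv s)" by blast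
  let ?T = "insert (rev s0) T"
  let ?c = "\<lambda>s. (if s = rev s0 then a else 0) + c s"
  have "ztail s0 0 = mzv (rev s0)" using s0(2) mzv_eq_ztail[of "rev s0"] by (auto simp: adm_def)
  moreover have "(\<Sum>s\<in>?T. c s * mzv s) = (\<Sum>s\<in>T. c s * mzv s)"
    using T by (intro sum.mono_neutral_right) auto
  moreover have "(\<Sum>s\<in>?T. (if s = rev s0 then a else 0) * mzv s) = a * mzv (rev s0)"
    using T by (simp add: if_distrib[of "\<lambda>c. c * _"] sum.delta cong: if_cong)
  ultimately have "\<forall>x. a * g x + f x = (\<Sum>s\<in>?T. ?c s * mzv s)"
    using T(4) s0 by (simp add: distrib_right sum.distrib del: sum.insert)
  then show ?case
    using T s0 step(1) by (intro exI[of _ ?T] exI[of _ ?c]) auto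
qed

lemma nested_sum_representation:
  assumes f: "\<And>j. j < p \<Longrightarrow> f j \<in> qspan (polar v)"
    and v: "\<And>j. v j \<le> A" "\<And>j. n < j \<Longrightarrow> v j = 0"
    and lead: "\<And>j. j < p \<Longrightarrow> leading n (f j) (D j)"
    and D: "\<And>j u. j < p \<Longrightarrow> D j u \<in> \<rat>"
    and sep: "\<And>j. M \<Longrightarrow> Suc j < p \<Longrightarrow> r (Suc j) + n + 1 \<le> r j"
  shows "\<exists>T c. finite T \<and> (\<forall>s\<in>T. adm p p (rev s) 0) \<and> (\<forall>s. c s \<in> \<rat> \<and> (s \<notin> T \<longrightarrow> c s = 0)) \<and>
    nested_sum 0 (rev (map (\<lambda>j x. f j (x + r j)) [0..<p])) 0 =
      (\<Sum>t\<in>tuples p. (\<Prod>j<p. D j (t ! j)) * mzv t) + (\<Sum>s\<in>T. c s * mzv s)"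
proof -
  define R where "R = (case p of 0 \<Rightarrow> r 0 + n + 1 | Suc i \<Rightarrow> r i)"
  obtain G where G': "G \<in> qspan (postsums R p p)"
    "\<forall>y. nested_sum 0 (rev (map (\<lambda>j x. f j (x + r j)) [0..<p])) y =
      (\<Sum>t\<in>tuples p. (\<Prod>j<p. D j (t ! j)) * ztail (rev t) (y + R)) + G y"
    using nested_sum_expansion[where p = p and f = f and v = v and n = n and D = D and r = r and i = p,
        OF f v lead D sep order_refl] unfolding R_def[symmetric] by blast
  note G = G'(1) G'(2)[rule_format, of 0, unfolded add_0]
  \<comment> \<open>The numbers \<open>mzv t\<close> are split off. Replacing the tails at
    \<open>R\<close> by them adds only terms of depth below \<open>p\<close>, so the depth
    \<open>p\<close> coefficients remain products of the \<open>D j\<close>.\<close>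
  let ?g = "\<lambda>_::nat. (\<Sum>t\<in>tuples p. (\<Prod>j<p. D j (t ! j)) * (ztail (rev t) R - ztail (rev t) 0)) + G 0"
  have "?g \<in> qspan (finals p p)"
  proof (intro qspan_add qspan_sum qspan_cmult postsums_final[OF G(1)])
    fix t assume "t \<in> tuples p"
    from ztail_final(1)[OF adm_tuple[OF this], of R] \<open>t \<in> tuples p\<close>
    show "(\<lambda>_. ztail (rev t) R - ztail (rev t) 0) \<in> qspan (finals p p)" by (simp add: tuples_def)
    show "(\<Prod>j<p. D j (t ! j)) \<in> \<rat>" using D by (intro Rats_prod) auto
  qed
  from finals_coefficients[OF this] obtain T c where T: "finite T" "\<forall>s\<in>T. adm p p (rev s) 0"
    "\<forall>s. c s \<in> \<rat> \<and> (s \<notin> T \<longrightarrow> c s = 0)" "?g 0 = (\<Sum>s\<in>T. c s * mzv s)" by blast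
  have "mzv t = ztail (rev t) 0" if "t \<in> tuples p" for t
    using that by (intro mzv_eq_ztail) (auto simp: tuples_def)
  then have "(\<Sum>t\<in>tuples p. (\<Prod>j<p. D j (t ! j)) * ztail (rev t) R) + G 0 =
      (\<Sum>t\<in>tuples p. (\<Prod>j<p. D j (t ! j)) * mzv t) + ?g 0"
    by (simp add: right_diff_distrib sum_subtractf)
  then show ?thesis using T G(2) by (intro exI[of _ T] exI[of _ c]) auto
qed

end

text \<open>With \<open>k = x + 1\<close>, this is a power of \<open>k + n/2\<close> over the
  denominator factor without its shift. At \<open>x + r i\<close> the base becomes
  \<open>k + r i + n/2\<close>, so the shift enters as a translation only.\<close>

definition basic_fraction :: "nat \<Rightarrow> nat \<Rightarrow> nat \<Rightarrow> nat \<Rightarrow> real" where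
  "basic_fraction A n m x = (real x + 1 + real n / 2) ^ m / pochhammer (real (x + 1)) (n + 1) ^ A"

lemma basic_fraction_polar:
  assumes "m + 2 \<le> A * (n + 1)"
  shows "basic_fraction A n m \<in> qspan (polar (\<lambda>j. if j \<le> n then A else 0))"
proof -
  let ?js = "concat (replicate A [0..<n + 1])"
  have cnt1: "count_list [0..<k] j = (if j < k then 1 else 0)" for k j
    by (induction k) auto
  have cnt: "count_list (concat (replicate N [0..<n + 1])) j = (if j \<le> n then N else 0)" for N j
    by (induction N) (use cnt1[of "n + 1" j] in auto)
  have "(\<Prod>j\<leftarrow>[0..<k]. pole 1 j x) = 1 / pochhammer (real (x + 1)) k" for k x
    by (induction k) (auto simp: pole_def pochhammer_Suc add_ac)
  then have "(\<Prod>j\<leftarrow>concat (replicate N [0..<n + 1]). pole 1 j x) = 1 / pochhammer (real (x + 1)) (n + 1) ^ N" for N x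
    by (induction N) (auto simp del: upt_Suc)
  then have eq: "basic_fraction A n m x = (real x + 1 + real n / 2) ^ m * (\<Prod>j\<leftarrow>?js. pole 1 j x)" for x
    by (simp add: basic_fraction_def)
  have "length ?js = A * (n + 1)" by (simp add: length_concat sum_list_replicate)
  then have "(\<lambda>x. (real x + 1 + real n / 2) ^ m * (\<Prod>j\<leftarrow>?js. pole 1 j x)) \<in> qspan (polar (count_list ?js))"
    using assms by (intro polar_cancel) auto
  moreover have "count_list ?js = (\<lambda>j. if j \<le> n then A else 0)" using cnt by (simp add: fun_eq_iff)
  ultimately show ?thesis by (simp only: eq[abs_def])
qed

section \<open>Polynomials and the cyclic symmetry\<close>

definition mono_eval :: "(nat \<Rightarrow> complex) \<Rightarrow> (nat \<Rightarrow>\<^sub>0 nat) \<Rightarrow> complex" where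
  "mono_eval y m = (\<Prod>i\<in>Poly_Mapping.keys m. y i ^ Poly_Mapping.lookup m i)"

lemma mono_eval_superset:
  assumes "finite N" "Poly_Mapping.keys m \<subseteq> N"
  shows "mono_eval y m = (\<Prod>i\<in>N. y i ^ Poly_Mapping.lookup m i)"
  unfolding mono_eval_def
  by (rule prod.mono_neutral_left) (use assms in \<open>auto simp: in_keys_iff\<close>)

lemma mono_eval_add: "mono_eval y (m + n) = mono_eval y m * mono_eval y n"
proof -
  let ?N = "Poly_Mapping.keys m \<union> Poly_Mapping.keys n"
  have "mono_eval y k = (\<Prod>i\<in>?N. y i ^ Poly_Mapping.lookup k i)" if "k \<in> {m, n, m + n}" for k
    by (rule mono_eval_superset) (use that keys_add[of m n] in auto)
  then show ?thesis by (simp add: lookup_add power_add prod.distrib)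
qed

lemma meval_eq: "meval y P = (\<Sum>m\<in>Poly_Mapping.keys P. Poly_Mapping.lookup P m * mono_eval y m)"
  by (simp add: minsertion_def mono_eval_def)

lemma meval_superset:
  assumes "finite N" "Poly_Mapping.keys P \<subseteq> N"
  shows "meval y P = (\<Sum>m\<in>N. Poly_Mapping.lookup P m * mono_eval y m)"
  unfolding meval_eq
  by (rule sum.mono_neutral_left) (use assms in \<open>auto simp: in_keys_iff\<close>)

lemma meval_add: "meval y (P + Q) = meval y P + meval y Q"
proof -
  let ?N = "Poly_Mapping.keys P \<union> Poly_Mapping.keys Q"
  have "meval y R = (\<Sum>m\<in>?N. Poly_Mapping.lookup R m * mono_eval y m)" if "R \<in> {P, Q, P + Q}" for R
    by (rule meval_superset) (use that keys_add[of P Q] in auto)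
  then show ?thesis by (simp add: lookup_add distrib_right sum.distrib)
qed

lemma meval_0 [simp]: "meval y 0 = 0" by (simp add: meval_eq)

lemma meval_sum: "meval y (\<Sum>i\<in>I. f i) = (\<Sum>i\<in>I. meval y (f i))"
  by (induction I rule: infinite_finite_induct) (simp_all add: meval_add)

lemma meval_single: "meval y (Poly_Mapping.single m c) = c * mono_eval y m"
  by (cases "c = 0") (simp_all add: meval_eq)

lemma sum_single_keys: "P = (\<Sum>m\<in>Poly_Mapping.keys P. Poly_Mapping.single m (Poly_Mapping.lookup P m))"
  by (rule poly_mapping_eqI)
    (simp add: lookup_sum lookup_single when_def in_keys_iff)

lemma mult_eq_sum_single:
  "P * Q = (\<Sum>m\<in>Poly_Mapping.keys P. \<Sum>m'\<in>Poly_Mapping.keys Q.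
     Poly_Mapping.single (m + m') (Poly_Mapping.lookup P m * Poly_Mapping.lookup Q m'))"
proof -
  have "P * Q = (\<Sum>m\<in>Poly_Mapping.keys P. Poly_Mapping.single m (Poly_Mapping.lookup P m)) *
      (\<Sum>m\<in>Poly_Mapping.keys Q. Poly_Mapping.single m (Poly_Mapping.lookup Q m))"
    by (simp flip: sum_single_keys)
  then show ?thesis by (simp add: sum_product mult_single)
qed

lemma meval_mult: "meval y (P * Q) = meval y P * meval y Q"
proof -
  have "meval y (P * Q) = (\<Sum>m\<in>Poly_Mapping.keys P. \<Sum>m'\<in>Poly_Mapping.keys Q.
      (Poly_Mapping.lookup P m * mono_eval y m) * (Poly_Mapping.lookup Q m' * mono_eval y m'))"
    by (simp only: mult_eq_sum_single meval_sum meval_single mono_eval_add mult_ac)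
  also have "\<dots> = meval y P * meval y Q" unfolding meval_eq by (rule sum_product[symmetric])
  finally show ?thesis .
qed

lemma meval_mConst [simp]: "meval y (mConst c) = c"
  by (simp add: mConst_def meval_single mono_eval_def)

lemma meval_1 [simp]: "meval y 1 = 1"
  using meval_mConst[of y 1] by (simp add: mConst_def)

lemma meval_mVar [simp]: "meval y (mVar i) = y i"
  by (simp add: mVar_def meval_single mono_eval_def)

lemma meval_diff: "meval y (P - Q) = meval y P - meval y Q"
  using meval_add[of y "P - Q" Q] by simp

lemma meval_power: "meval y (P ^ k) = meval y P ^ k"
  by (induction k) (simp_all add: meval_mult)

lemma meval_prod: "meval y (\<Prod>i\<in>I. f i) = (\<Prod>i\<in>I. meval y (f i))"
  by (induction I rule: infinite_finite_induct) (simp_all add: meval_mult)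

lemma msubst_eq:
  "msubst g P = (\<Sum>m\<in>Poly_Mapping.keys P. mConst (Poly_Mapping.lookup P m) *
     (\<Prod>i\<in>Poly_Mapping.keys m. g i ^ Poly_Mapping.lookup m i))"
  by (simp add: minsertion_def)

lemma meval_msubst: "meval y (msubst g P) = meval (\<lambda>i. meval y (g i)) P"
  by (simp add: msubst_eq meval_sum meval_mult meval_prod meval_power meval_eq[of _ P] mono_eval_def)

section \<open>Subfields and degree bounds\<close>

lemma subfield_rat_adjoin: "subfield_of_complex (rat_adjoin \<xi>)"
  unfolding rat_adjoin_def by (rule hull_in) (auto simp: subfield_of_complex_def)

locale subfield =
  fixes K :: "complex set"
  assumes subfield: "subfield_of_complex K"
begin

lemma K_1: "1 \<in> K" and K_diff: "x \<in> K \<Longrightarrow> y \<in> K \<Longrightarrow> x - y \<in> K"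
  and K_mult: "x \<in> K \<Longrightarrow> y \<in> K \<Longrightarrow> x * y \<in> K"
  and K_inverse: "x \<in> K \<Longrightarrow> x \<noteq> 0 \<Longrightarrow> inverse x \<in> K"
  using subfield by (auto simp: subfield_of_complex_def)

lemma K_0: "0 \<in> K" using K_diff[OF K_1 K_1] by simp

lemma K_uminus: "x \<in> K \<Longrightarrow> - x \<in> K" using K_diff[OF K_0] by fastforce

lemma K_add: "x \<in> K \<Longrightarrow> y \<in> K \<Longrightarrow> x + y \<in> K" using K_diff[OF _ K_uminus] by fastforce

lemma K_divide: "x \<in> K \<Longrightarrow> y \<in> K \<Longrightarrow> x / y \<in> K"
  by (cases "y = 0") (simp_all add: K_0 K_mult K_inverse divide_inverse)

lemma K_sum: "(\<And>i. i \<in> I \<Longrightarrow> f i \<in> K) \<Longrightarrow> sum f I \<in> K"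
  by (induction I rule: infinite_finite_induct) (auto intro: K_0 K_add)

lemma K_of_nat: "of_nat k \<in> K"
  by (induction k) (auto intro: K_0 K_1 K_add)

lemma K_of_int: "of_int k \<in> K"
  by (cases k rule: int_cases2) (auto intro: K_of_nat K_uminus)

lemma K_of_real: assumes "q \<in> \<rat>" shows "of_real q \<in> K"
proof -
  obtain a b where "q = of_int a / of_int b" using assms by (auto elim: Rats_cases')
  then show ?thesis using K_divide[OF K_of_int K_of_int] by simp
qed

text \<open>Only the degree in variable 0 is recorded: this is the bound at hand, and
  \<open>degree_bound_rotate\<close> transports it to the other variables.\<close>

definition bounded_polys :: "nat \<Rightarrow> nat \<Rightarrow> cmpoly set" where
  "bounded_polys p d = {R. (\<forall>m. Poly_Mapping.lookup R m \<in> K) \<and>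
     (\<forall>m\<in>Poly_Mapping.keys R. Poly_Mapping.keys m \<subseteq> {..<p} \<and> Poly_Mapping.lookup m 0 \<le> d)}"

lemma bounded_polys_add: "P \<in> bounded_polys p d \<Longrightarrow> Q \<in> bounded_polys p d \<Longrightarrow> P + Q \<in> bounded_polys p d"
  using keys_add[of P Q] unfolding bounded_polys_def by (simp add: lookup_add K_add) blast

lemma bounded_polys_single:
  "c \<in> K \<Longrightarrow> Poly_Mapping.keys m \<subseteq> {..<p} \<Longrightarrow> Poly_Mapping.lookup m 0 \<le> d \<Longrightarrow>
    Poly_Mapping.single m c \<in> bounded_polys p d"
  by (auto simp: bounded_polys_def lookup_single when_def K_0)

lemma bounded_polys_sum: "(\<And>i. i \<in> I \<Longrightarrow> f i \<in> bounded_polys p d) \<Longrightarrow> sum f I \<in> bounded_polys p d"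
proof (induction I rule: infinite_finite_induct)
  case (insert i I)
  then show ?case by (simp add: bounded_polys_add)
qed (simp_all add: bounded_polys_def K_0)

lemma bounded_polys_mult:
  assumes "P \<in> bounded_polys p d" "Q \<in> bounded_polys p e"
  shows "P * Q \<in> bounded_polys p (d + e)"
  unfolding mult_eq_sum_single
proof (intro bounded_polys_sum bounded_polys_single)
  fix m m' assume m: "m \<in> Poly_Mapping.keys P" "m' \<in> Poly_Mapping.keys Q"
  show "Poly_Mapping.lookup P m * Poly_Mapping.lookup Q m' \<in> K"
    using assms by (auto simp: bounded_polys_def intro: K_mult)
  show "Poly_Mapping.keys (m + m') \<subseteq> {..<p}"
    using assms m keys_add[of m m'] unfolding bounded_polys_def by blast
  show "Poly_Mapping.lookup (m + m') 0 \<le> d + e"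
    using assms m by (auto simp: bounded_polys_def lookup_add intro: add_mono)
qed

lemma bounded_polys_1: "1 \<in> bounded_polys p 0"
  using bounded_polys_single[OF K_1, of 0 p 0] by simp

lemma bounded_polys_power: "P \<in> bounded_polys p d \<Longrightarrow> P ^ k \<in> bounded_polys p (k * d)"
  by (induction k) (auto intro: bounded_polys_1 bounded_polys_mult)

lemma bounded_polys_prod:
  "(\<And>i. i \<in> I \<Longrightarrow> f i \<in> bounded_polys p (e i)) \<Longrightarrow> prod f I \<in> bounded_polys p (sum e I)"
  by (induction I rule: infinite_finite_induct) (auto intro: bounded_polys_1 bounded_polys_mult)

lemma bounded_polys_mono: "P \<in> bounded_polys p d \<Longrightarrow> d \<le> e \<Longrightarrow> P \<in> bounded_polys p e"
  by (force simp: bounded_polys_def)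

lemma bounded_polys_msubst:
  assumes P: "P \<in> bounded_polys p d" and c: "\<And>i. c i \<in> K"
  shows "msubst (\<lambda>i. mVar i - mConst (c i)) P \<in> bounded_polys p d"
  unfolding msubst_eq
proof (intro bounded_polys_sum)
  fix m assume m: "m \<in> Poly_Mapping.keys P"
  \<comment> \<open>Translating a variable does not raise degrees; the weight \<open>?e\<close>
    counts variable 0 alone.\<close>
  let ?e = "\<lambda>i. if i = 0 then 1 else 0 :: nat"
  have km: "Poly_Mapping.keys m \<subseteq> {..<p}" "Poly_Mapping.lookup m 0 \<le> d"
    using P m by (auto simp: bounded_polys_def)
  have g: "mVar i - mConst (c i) \<in> bounded_polys p (?e i)" if "i < p" for i
  proof -
    have "mVar i + mConst (- c i) \<in> bounded_polys p (?e i)"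
      unfolding mVar_def mConst_def using that c
      by (intro bounded_polys_add bounded_polys_single K_1 K_uminus)
        (auto simp: lookup_single when_def)
    then show ?thesis by (simp add: mConst_def single_uminus)
  qed
  have "(\<Prod>i\<in>Poly_Mapping.keys m. (mVar i - mConst (c i)) ^ Poly_Mapping.lookup m i)
      \<in> bounded_polys p (\<Sum>i\<in>Poly_Mapping.keys m. Poly_Mapping.lookup m i * ?e i)"
    by (intro bounded_polys_prod bounded_polys_power g) (use km in auto)
  moreover have "(\<Sum>i\<in>Poly_Mapping.keys m. Poly_Mapping.lookup m i * ?e i) \<le> Poly_Mapping.lookup m 0"
    by (simp add: if_distrib[of "\<lambda>e. _ * e"] cong: if_cong)
  ultimately have "(\<Prod>i\<in>Poly_Mapping.keys m. (mVar i - mConst (c i)) ^ Poly_Mapping.lookup m i)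
      \<in> bounded_polys p d"
    using km by (elim bounded_polys_mono) simp
  moreover have "mConst (Poly_Mapping.lookup P m) \<in> bounded_polys p 0"
    unfolding mConst_def using P by (intro bounded_polys_single) (auto simp: bounded_polys_def)
  ultimately show "mConst (Poly_Mapping.lookup P m) *
      (\<Prod>i\<in>Poly_Mapping.keys m. (mVar i - mConst (c i)) ^ Poly_Mapping.lookup m i) \<in> bounded_polys p d"
    using bounded_polys_mult by fastforce
qed

text \<open>Distinct indices may give equal values \<open>x i\<close>, whereas
  \<open>linear_combinations\<close> sums over a set; coefficients are first collected over the
  fibres.\<close>

lemma linear_combinations_sum:
  assumes "finite I" "\<And>i. i \<in> I \<Longrightarrow> a i \<in> K" "\<And>i. i \<in> I \<Longrightarrow> x i \<in> X"
  shows "(\<Sum>i\<in>I. a i * x i) \<in> linear_combinations K X"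
proof -
  let ?b = "\<lambda>z. \<Sum>i\<in>{i\<in>I. x i = z}. a i"
  have "(\<Sum>i\<in>I. a i * x i) = (\<Sum>z\<in>x ` I. \<Sum>i\<in>{i\<in>I. x i = z}. a i * x i)"
    by (rule sum.image_gen[OF assms(1)])
  also have "\<dots> = (\<Sum>z\<in>x ` I. ?b z * z)"
    by (auto simp: sum_distrib_right intro!: sum.cong)
  finally have "(\<Sum>i\<in>I. a i * x i) = (\<Sum>z\<in>x ` I. ?b z * z)" .
  then show ?thesis
    unfolding linear_combinations_def using assms
    by (intro CollectI exI[of _ "x ` I"] exI[of _ ?b]) (auto intro!: K_sum)
qed

end

section \<open>Rotation of exponents\<close>

definition mono_rotate :: "nat \<Rightarrow> (nat \<Rightarrow>\<^sub>0 nat) \<Rightarrow> (nat \<Rightarrow>\<^sub>0 nat)" where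
  "mono_rotate p m = (\<Sum>i\<in>Poly_Mapping.keys m. Poly_Mapping.single ((i + 1) mod p) (Poly_Mapping.lookup m i))"

lemma rotate_index_inj:
  assumes "i < p" "j < p" "(i + 1) mod p = (j + 1) mod (p :: nat)"
  shows "i = j"
proof -
  have "(k + 1) mod p = (if k = p - 1 then 0 else k + 1)" if "k < p" for k
    using that by (cases "k = p - 1") auto
  from this[OF assms(1)] this[OF assms(2)]
  have "(if i = p - 1 then 0 else i + 1) = (if j = p - 1 then 0 else j + 1)"
    by (simp only: assms(3))
  then show ?thesis by (simp split: if_splits)
qed

lemma lookup_mono_rotate:
  assumes "Poly_Mapping.keys m \<subseteq> {..<p}" "i < p"
  shows "Poly_Mapping.lookup (mono_rotate p m) ((i + 1) mod p) = Poly_Mapping.lookup m i"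
proof -
  have "Poly_Mapping.lookup (mono_rotate p m) ((i + 1) mod p) =
      (\<Sum>j\<in>Poly_Mapping.keys m. if j = i then Poly_Mapping.lookup m j else 0)"
    unfolding mono_rotate_def lookup_sum lookup_single when_def
    by (rule sum.cong) (use assms rotate_index_inj[of _ p i] in auto)
  then show ?thesis by (simp add: in_keys_iff)
qed

lemma mono_rotate_inj: "inj_on (mono_rotate p) {m. Poly_Mapping.keys m \<subseteq> {..<p}}"
proof (rule inj_onI, elim CollectE)
  fix m m' assume m: "Poly_Mapping.keys m \<subseteq> {..<p}" "Poly_Mapping.keys m' \<subseteq> {..<p}"
    "mono_rotate p m = mono_rotate p m'"
  show "m = m'"
  proof (rule poly_mapping_eqI)
    fix i
    show "Poly_Mapping.lookup m i = Poly_Mapping.lookup m' i"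
    proof (cases "i < p")
      case True
      then show ?thesis using m lookup_mono_rotate by metis
    next
      case False
      then have "i \<notin> Poly_Mapping.keys m" "i \<notin> Poly_Mapping.keys m'" using m by auto
      then show ?thesis by (simp add: in_keys_iff)
    qed
  qed
qed

lemma msubst_rotate:
  "msubst (\<lambda>i. mVar ((i + 1) mod p)) Q =
    (\<Sum>m\<in>Poly_Mapping.keys Q. Poly_Mapping.single (mono_rotate p m) (Poly_Mapping.lookup Q m))"
proof -
  have pow: "mVar j ^ k = Poly_Mapping.single (Poly_Mapping.single j k) 1" for j k
  proof (induction k)
    case (Suc k)
    then show ?case by (simp add: mVar_def mult_single single_add[symmetric] add.commute)
  qed simp
  have prod: "(\<Prod>i\<in>I. Poly_Mapping.single (f i) (1::complex)) = Poly_Mapping.single (\<Sum>i\<in>I. f i) 1"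
    for I :: "nat set" and f :: "nat \<Rightarrow> nat \<Rightarrow>\<^sub>0 nat"
    by (induction I rule: infinite_finite_induct) (simp_all add: mult_single)
  show ?thesis
    unfolding msubst_eq by (simp add: pow prod mConst_def mult_single mono_rotate_def)
qed

text \<open>Both sides of the symmetry are compared at the rotated monomial. Rotation is injective
  on monomials in the first \<open>p\<close> variables, so a single term survives on the
  left.\<close>

lemma lookup_rotate_invariant:
  assumes inv: "msubst (\<lambda>i. mVar ((i + 1) mod p)) Q = mConst \<xi> * Q"
    and keys: "\<forall>m\<in>Poly_Mapping.keys Q. Poly_Mapping.keys m \<subseteq> {..<p}" and m: "m \<in> Poly_Mapping.keys Q"
  shows "Poly_Mapping.lookup Q m = \<xi> * Poly_Mapping.lookup Q (mono_rotate p m)"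
proof -
  have inj: "mono_rotate p m' = mono_rotate p m \<longleftrightarrow> m' = m" if "m' \<in> Poly_Mapping.keys Q" for m'
    using mono_rotate_inj[of p] that keys m by (auto simp: inj_on_def)
  have "Poly_Mapping.lookup (msubst (\<lambda>i. mVar ((i + 1) mod p)) Q) (mono_rotate p m) =
      (\<Sum>m'\<in>Poly_Mapping.keys Q. if m' = m then Poly_Mapping.lookup Q m' else 0)"
    unfolding msubst_rotate lookup_sum lookup_single when_def
    by (rule sum.cong) (use inj in auto)
  also have "\<dots> = Poly_Mapping.lookup Q m" using m by simp
  finally have "Poly_Mapping.lookup Q m = Poly_Mapping.lookup (Poly_Mapping.map ((*) \<xi>) Q) (mono_rotate p m)"
    by (simp only: inv mConst_def mult_map_scale_conv_mult)
  then show ?thesis by (simp add: Poly_Mapping.map.rep_eq when_def split: if_splits)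
qed

text \<open>The exponent of variable \<open>i\<close> becomes that of \<open>i + 1\<close> after
  rotation, and \<open>p - 1\<close> wraps to 0. The bound therefore reaches \<open>p - 1\<close>
  first and spreads downwards.\<close>

lemma degree_bound_rotate:
  assumes keys: "\<forall>m\<in>Poly_Mapping.keys Q. Poly_Mapping.keys m \<subseteq> {..<p}"
    and rot: "\<forall>m\<in>Poly_Mapping.keys Q. mono_rotate p m \<in> Poly_Mapping.keys Q"
    and d: "\<forall>m\<in>Poly_Mapping.keys Q. Poly_Mapping.lookup m 0 \<le> d" and "i < p"
  shows "\<forall>m\<in>Poly_Mapping.keys Q. Poly_Mapping.lookup m i \<le> d"
proof -
  have "i \<le> p - 1" using \<open>i < p\<close> by simp
  then show ?thesis
  proof (induction i rule: inc_induct)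
    case base
    show ?case
    proof
      fix m assume m: "m \<in> Poly_Mapping.keys Q"
      have "Poly_Mapping.lookup m (p - 1) = Poly_Mapping.lookup (mono_rotate p m) 0"
        using lookup_mono_rotate[of m p "p - 1"] keys m \<open>i < p\<close> by auto
      then show "Poly_Mapping.lookup m (p - 1) \<le> d" using d rot m by auto
    qed
  next
    case (step i)
    show ?case
    proof
      fix m assume m: "m \<in> Poly_Mapping.keys Q"
      have "Poly_Mapping.lookup m i = Poly_Mapping.lookup (mono_rotate p m) (Suc i)"
        using lookup_mono_rotate[of m p i] keys m step by auto
      then show "Poly_Mapping.lookup m i \<le> d" using step rot m by auto
    qed
  qed
qed

lemma has_sum_finite_sum:
  fixes f :: "'i \<Rightarrow> 'a \<Rightarrow> 'b :: topological_comm_monoid_add"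
  assumes "\<And>i. i \<in> I \<Longrightarrow> (f i has_sum s i) A"
  shows "((\<lambda>x. \<Sum>i\<in>I. f i x) has_sum (\<Sum>i\<in>I. s i)) A"
  using assms by (induction I rule: infinite_finite_induct) (auto intro!: has_sum_add)

text \<open>Each monomial of \<open>Q\<close> factors over the variables, and the degree bound makes
  every factor summable on its own; the finite sum over monomials may then be interchanged with the
  multiple sum.\<close>

lemma multiple_sum_expansion:
  assumes keys: "\<forall>m\<in>Poly_Mapping.keys Q. Poly_Mapping.keys m \<subseteq> {..<p}"
    and deg: "\<And>m i. m \<in> Poly_Mapping.keys Q \<Longrightarrow> i < p \<Longrightarrow> Poly_Mapping.lookup m i + 2 \<le> A * (n + 1)"
    and Q: "Q = msubst (\<lambda>i. mVar i - mConst (of_nat (r i) + of_nat n / 2)) P"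
  shows "multiple_sum p A n r P = (\<Sum>m\<in>Poly_Mapping.keys Q. Poly_Mapping.lookup Q m *
    of_real (nested_sum 0 (rev (map (\<lambda>j x. basic_fraction A n (Poly_Mapping.lookup m j) (x + r j)) [0..<p])) 0))"
    (is "_ = (\<Sum>m\<in>_. _ * of_real (nested_sum 0 (?fs m) 0))")
proof -
  have sm: "f summable_on UNIV" if mf: "m \<in> Poly_Mapping.keys Q" "f \<in> set (?fs m)" for m f
  proof -
    obtain j where j: "j < p" "f = (\<lambda>x. basic_fraction A n (Poly_Mapping.lookup m j) (x + r j))"
      using mf by auto
    let ?b = "basic_fraction A n (Poly_Mapping.lookup m j)"
    have "?b summable_on UNIV"
      by (rule polar_summable[OF basic_fraction_polar[OF deg[OF mf(1) j(1)]]])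
    then have "?b summable_on (\<lambda>x. x + r j) ` UNIV" by (rule summable_on_subset_banach) auto
    then have "(?b \<circ> (\<lambda>x. x + r j)) summable_on UNIV"
      by (subst (asm) summable_on_reindex) (auto simp: inj_on_def)
    then show ?thesis by (simp add: j(2) o_def)
  qed
  let ?C = "{ks :: nat list. length ks = p \<and> sorted_wrt (\<ge>) ks \<and> (\<forall>k\<in>set ks. 1 \<le> k)}"
  have C: "chains 0 p 0 = ?C" by (simp add: chains_def Suc_le_eq)
  have "((\<lambda>ks. \<Sum>m\<in>Poly_Mapping.keys Q. Poly_Mapping.lookup Q m * of_real (list_prod (?fs m) ks)) has_sum
      (\<Sum>m\<in>Poly_Mapping.keys Q. Poly_Mapping.lookup Q m * of_real (nested_sum 0 (?fs m) 0))) ?C"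
  proof (intro has_sum_finite_sum has_sum_cmult_right has_sum_of_real)
    fix m assume "m \<in> Poly_Mapping.keys Q"
    then show "(list_prod (?fs m) has_sum nested_sum 0 (?fs m) 0) ?C"
      using nested_sum_eq_infsum[of "?fs m" 0 0] sm by (simp add: C)
  qed
  moreover have "(\<Sum>m\<in>Poly_Mapping.keys Q. Poly_Mapping.lookup Q m * of_real (list_prod (?fs m) ks)) =
      meval (\<lambda>i. of_nat (ks ! i)) P / (\<Prod>i<p. pochhammer (of_nat (ks ! i + r i)) (n + 1) ^ A)"
    if "ks \<in> ?C" for ks
  proof -
    let ?y = "\<lambda>i. of_nat (ks ! i + r i) + of_nat n / 2 :: complex"
    define D :: complex where "D = (\<Prod>i<p. pochhammer (of_nat (ks ! i + r i)) (n + 1) ^ A)"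
    have pos: "1 \<le> ks ! i" if "i < p" for i using \<open>ks \<in> ?C\<close> that by auto
    \<comment> \<open>\<open>Q\<close> is \<open>P\<close> with each variable translated back by
      \<open>r i + n/2\<close>, so evaluating \<open>Q\<close> at the translated point restores
      \<open>P\<close>.\<close>
    have "meval (\<lambda>i. of_nat (ks ! i)) P = meval ?y Q"
      unfolding Q meval_msubst by (simp add: meval_diff)
    then have "meval (\<lambda>i. of_nat (ks ! i)) P / D = (\<Sum>m\<in>Poly_Mapping.keys Q. Poly_Mapping.lookup Q m * (mono_eval ?y m / D))"
      by (simp only: meval_eq sum_divide_distrib times_divide_eq_right)
    also have "\<dots> = (\<Sum>m\<in>Poly_Mapping.keys Q. Poly_Mapping.lookup Q m * of_real (list_prod (?fs m) ks))"
    proof (rule sum.cong)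
      fix m assume m: "m \<in> Poly_Mapping.keys Q"
      have "mono_eval ?y m / D = (\<Prod>i<p. ?y i ^ Poly_Mapping.lookup m i /
          pochhammer (of_nat (ks ! i + r i)) (n + 1) ^ A)"
        using keys m by (simp only: mono_eval_superset[of "{..<p}"] finite_lessThan D_def prod_dividef)
      also have "\<dots> = (\<Prod>i<p. of_real (basic_fraction A n (Poly_Mapping.lookup m i) (ks ! i - 1 + r i)))"
      proof (rule prod.cong)
        fix i assume "i \<in> {..<p}"
        then have "ks ! i - 1 + r i + 1 = ks ! i + r i" "real (ks ! i - 1 + r i) + 1 = real (ks ! i + r i)"
          using pos[of i] by auto
        then show "?y i ^ Poly_Mapping.lookup m i / pochhammer (of_nat (ks ! i + r i)) (n + 1) ^ A =
            of_real (basic_fraction A n (Poly_Mapping.lookup m i) (ks ! i - 1 + r i))"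
          unfolding basic_fraction_def
          by (simp only: of_real_divide of_real_power of_real_add pochhammer_of_real[symmetric] of_real_of_nat_eq
              of_real_numeral)
      qed simp
      also have "\<dots> = of_real (list_prod (?fs m) ks)"
        unfolding list_prod_def by simp
      finally show "Poly_Mapping.lookup Q m * (mono_eval ?y m / D) =
          Poly_Mapping.lookup Q m * of_real (list_prod (?fs m) ks)" by simp
    qed simp
    finally show ?thesis unfolding D_def ..
  qed
  ultimately show ?thesis
    unfolding multiple_sum_def by (metis (no_types, lifting) infsumI infsum_cong)
qed

context exponent_bound
begin

lemma sum_tuples_rotate: "(\<Sum>t\<in>tuples p. F (rotate i t)) = (\<Sum>t\<in>tuples p. F t)"
proof (induction i)
  case (Suc i)
  have "rotate1 ` tuples p \<subseteq> tuples p" by (auto simp: tuples_def)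
  moreover have inj: "inj_on rotate1 (tuples p)" using inj_rotate1 by (rule inj_on_subset) simp
  ultimately have img: "rotate1 ` tuples p = tuples p" by (intro endo_inj_surj finite_tuples)
  have "(\<Sum>t\<in>rotate1 ` tuples p. F (rotate i t)) = (\<Sum>t\<in>tuples p. F (rotate i (rotate1 t)))"
    using sum.reindex[OF inj, of "\<lambda>t. F (rotate i t)"] by (simp add: o_def)
  then show ?case using Suc img by (simp add: rotate1_rotate_swap)
qed simp

lemma adm_chain:
  assumes ad: "adm p (Suc p) (rev s) 0" and "s \<noteq> []"
  shows "\<exists>l :: nat \<Rightarrow> nat. l 0 = 1 \<and> l (length s) = p + 1 \<and>
           (\<forall>j<length s. l j < l (j + 1) \<and> s ! j \<le> (l (j + 1) - l j) * A)"
proof -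
  define c where "c = (\<lambda>j. \<Sum>i<j. cl (s ! i))"
  \<comment> \<open>Partial sums of ceilings, starting at 1. Their total may fall short of
    \<open>p\<close>, so the last link is stretched to end at \<open>p + 1\<close>.\<close>
  define l where "l = (\<lambda>j. if j = length s then p + 1 else 1 + c j)"
  have "(\<Sum>x\<leftarrow>s. cl x) \<le> p" using ad by (simp add: adm_def rev_map[symmetric])
  then have tot: "c (length s) \<le> p" by (simp add: c_def sum_list_sum_nth atLeast0LessThan)
  have step: "l j + cl (s ! j) \<le> l (j + 1)" if "j < length s" for j
  proof -
    have "c (j + 1) = c j + cl (s ! j)" by (simp add: c_def)
    moreover have "c (j + 1) \<le> p" if "j + 1 = length s" using tot that by simp
    ultimately show ?thesis using that by (auto simp: l_def)
  qed
  have "l j < l (j + 1) \<and> s ! j \<le> (l (j + 1) - l j) * A" if "j < length s" for j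
  proof
    have "2 \<le> s ! j" using ad that by (auto simp: adm_def)
    then show "l j < l (j + 1)" using step[OF that] cl_pos[of "s ! j"] by simp
    have "s ! j \<le> cl (s ! j) * A" by (rule cl_ge)
    also have "\<dots> \<le> (l (j + 1) - l j) * A" using step[OF that] by (intro mult_right_mono) auto
    finally show "s ! j \<le> (l (j + 1) - l j) * A" .
  qed
  moreover have "l 0 = 1" "l (length s) = p + 1" using \<open>s \<noteq> []\<close> by (auto simp: l_def c_def)
  ultimately show ?thesis by blast
qed

end

section \<open>The representation\<close>

text \<open>The sum equals each of its rotated copies, and the mean of \<open>p\<close> copies
  regroups into the cyclic sums. Division by \<open>p\<close> stays within \<open>K\<close>.\<close>

lemma rotate_sum_combination:
  fixes \<xi> :: complex
  assumes K: "subfield_of_complex K" and p: "1 \<le> p" and T: "finite T" "\<And>t. t \<in> T \<Longrightarrow> d t \<in> K"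
    and X: "\<And>t. t \<in> T \<Longrightarrow> (\<Sum>i<p. \<xi> ^ i * z (rotate i t)) \<in> X"
    and rot: "\<And>F :: nat list \<Rightarrow> complex. \<And>i. (\<Sum>t\<in>T. F (rotate i t)) = (\<Sum>t\<in>T. F t)"
    and d: "\<And>t i. t \<in> T \<Longrightarrow> d (rotate i t) = \<xi> ^ i * d t"
  shows "(\<Sum>t\<in>T. d t * z t) \<in> linear_combinations K X"
proof -
  interpret subfield K by standard (rule K)
  let ?L = "\<Sum>t\<in>T. d t * z t"
  have "of_nat p * ?L = (\<Sum>i<p. \<Sum>t\<in>T. d (rotate i t) * z (rotate i t))"
    using rot[of "\<lambda>t. d t * z t"] by simp
  also have "\<dots> = (\<Sum>i<p. \<Sum>t\<in>T. d t * (\<xi> ^ i * z (rotate i t)))"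
    by (intro sum.cong refl) (simp add: d)
  also have "\<dots> = (\<Sum>t\<in>T. d t * (\<Sum>i<p. \<xi> ^ i * z (rotate i t)))"
    by (subst sum.swap) (simp add: sum_distrib_left)
  finally have "?L = (\<Sum>t\<in>T. d t / of_nat p * (\<Sum>i<p. \<xi> ^ i * z (rotate i t)))"
    using p by (simp add: field_simps sum_divide_distrib[symmetric])
  also have "\<dots> \<in> linear_combinations K X"
    using T X by (intro linear_combinations_sum K_divide K_of_nat)
  finally show ?thesis .
qed

lemma admissible_representation_exists:
  fixes \<xi> :: complex
  assumes p: "p \<ge> 1" and A: "1 \<le> A"
    and P: "P \<in> mpolys_over (rat_adjoin \<xi>) p"
    and deg: "\<And>m. m \<in> Poly_Mapping.keys P \<Longrightarrow> Poly_Mapping.lookup m 0 + 2 \<le> A * (n + 1)"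
    and Q: "Q = msubst (\<lambda>i. mVar i - mConst (of_nat (r i) + of_nat n / 2)) P"
    and inv: "msubst (\<lambda>i. mVar ((i + 1) mod p)) Q = mConst \<xi> * Q"
  shows "\<exists>c. admissible_representation (rat_adjoin \<xi>) p A n r P (multiple_sum p A n r P) c \<and>
           (\<Sum>s | c s \<noteq> 0 \<and> length s = p. c s * of_real (mzv s))
             \<in> linear_combinations (rat_adjoin \<xi>)
                 {\<Sum>i<p. \<xi> ^ i * of_real (mzv (rotate i s)) | s.
                    length s = p \<and> (\<forall>x\<in>set s. 2 \<le> x)}"
proof -
  define K where "K = rat_adjoin \<xi>"
  interpret subfield K by standard (simp add: K_def subfield_rat_adjoin)
  define M where "M \<longleftrightarrow> (\<forall>i. i + 1 < p \<longrightarrow> r i \<ge> r (i + 1) + n + 1)"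
  interpret exponent_bound A M by standard (rule A)
  let ?N = "Poly_Mapping.keys Q"
  let ?q = "Poly_Mapping.lookup Q"
  let ?e = "Poly_Mapping.lookup"
  have "P \<in> mpolys_over K p" using P by (simp add: K_def)
  then have "P \<in> bounded_polys p (A * (n + 1) - 2)"
    using deg by (force simp: bounded_polys_def mpolys_over_def)
  then have QB: "Q \<in> bounded_polys p (A * (n + 1) - 2)"
    unfolding Q by (rule bounded_polys_msubst) (intro K_add K_divide K_of_nat K_of_nat[of 2, simplified])
  have keys: "\<forall>m\<in>?N. Poly_Mapping.keys m \<subseteq> {..<p}" and qK: "\<And>m. ?q m \<in> K"
    and d0: "\<forall>m\<in>?N. ?e m 0 \<le> A * (n + 1) - 2"
    using QB by (auto simp: bounded_polys_def)
  note qrot = lookup_rotate_invariant[OF inv keys]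
  have rotN: "\<forall>m\<in>?N. mono_rotate p m \<in> ?N"
  proof
    fix m assume m: "m \<in> ?N"
    then have "?q m \<noteq> 0" by (simp add: in_keys_iff)
    then have "?q (mono_rotate p m) \<noteq> 0" using qrot[OF m] by auto
    then show "mono_rotate p m \<in> ?N" by (simp add: in_keys_iff)
  qed
  \<comment> \<open>The bound in \<open>d0\<close> uses truncated subtraction and is informative
    only when \<open>2 <= A * (n + 1)\<close>; one monomial of \<open>P\<close> guarantees
    this.\<close>
  have two: "2 \<le> A * (n + 1)" if "m \<in> ?N" for m
  proof -
    have "P \<noteq> 0" using that by (auto simp: Q minsertion_def)
    then obtain m' where "m' \<in> Poly_Mapping.keys P" by fastforce
    then show ?thesis using deg by fastforce
  qed
  have dN: "?e m i + 2 \<le> A * (n + 1)" if "m \<in> ?N" "i < p" for m i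
    using degree_bound_rotate[OF keys rotN d0 that(2)] two[OF that(1)] that(1) by fastforce
  let ?v = "\<lambda>j. if j \<le> n then A else 0"
  \<comment> \<open>\<open>D\<close> is chosen per exponent \<open>k\<close>, independently of the
    variable and its shift, so that rotating a tuple can be traded for rotating a monomial.\<close>
  have "\<forall>k. \<exists>D. k + 2 \<le> A * (n + 1) \<longrightarrow> (\<forall>u. D u \<in> \<rat>) \<and> leading n (basic_fraction A n k) D"
  proof
    fix k
    show "\<exists>D. k + 2 \<le> A * (n + 1) \<longrightarrow> (\<forall>u. D u \<in> \<rat>) \<and> leading n (basic_fraction A n k) D"
    proof (cases "k + 2 \<le> A * (n + 1)")
      case True
      from leading_exists[OF basic_fraction_polar[OF True], of n] show ?thesis by auto
    qed blast
  qed
  then obtain D where D: "\<And>k u. k + 2 \<le> A * (n + 1) \<Longrightarrow> D k u \<in> \<rat>"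
    "\<And>k. k + 2 \<le> A * (n + 1) \<Longrightarrow> leading n (basic_fraction A n k) (D k)" by metis
  let ?S = "\<lambda>m. nested_sum 0 (rev (map (\<lambda>j x. basic_fraction A n (?e m j) (x + r j)) [0..<p])) 0"
  let ?d = "\<lambda>m t. \<Prod>j<p. D (?e m j) (t ! j)"
  define rep where "rep m T c \<longleftrightarrow> finite T \<and> (\<forall>s\<in>T. adm p p (rev s) 0) \<and>
      (\<forall>s. c s \<in> \<rat> \<and> (s \<notin> T \<longrightarrow> c s = 0)) \<and>
      ?S m = (\<Sum>t\<in>tuples p. ?d m t * mzv t) + (\<Sum>s\<in>T. c s * mzv s)" for m T c
  have "\<exists>T c. rep m T c" if m: "m \<in> ?N" for m
    unfolding rep_def
  proof (rule nested_sum_representation[where v = ?v and n = n and f = "\<lambda>j. basic_fraction A n (?e m j)"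
        and D = "\<lambda>j. D (?e m j)"])
    fix j assume "j < p"
    then have e: "?e m j + 2 \<le> A * (n + 1)" using dN m by blast
    show "basic_fraction A n (?e m j) \<in> qspan (polar ?v)" by (rule basic_fraction_polar[OF e])
    show "leading n (basic_fraction A n (?e m j)) (D (?e m j))" by (rule D(2)[OF e])
    show "D (?e m j) u \<in> \<rat>" for u by (rule D(1)[OF e])
  qed (auto simp: M_def)
  then obtain T c where rep: "\<And>m. m \<in> ?N \<Longrightarrow> rep m (T m) (c m)" by metis
  have T: "\<And>m. m \<in> ?N \<Longrightarrow> finite (T m)"
    "\<And>m s. m \<in> ?N \<Longrightarrow> s \<in> T m \<Longrightarrow> adm p p (rev s) 0"
    "\<And>m s. m \<in> ?N \<Longrightarrow> c m s \<in> \<rat>" "\<And>m s. m \<in> ?N \<Longrightarrow> s \<notin> T m \<Longrightarrow> c m s = 0"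
    "\<And>m. m \<in> ?N \<Longrightarrow> ?S m = (\<Sum>t\<in>tuples p. ?d m t * mzv t) + (\<Sum>s\<in>T m. c m s * mzv s)"
    using rep unfolding rep_def by blast+
  define W where "W = (\<Union>m\<in>?N. T m)"
  define DD :: "nat list \<Rightarrow> complex" where "DD t = (\<Sum>m\<in>?N. ?q m * of_real (?d m t))" for t
  define low :: "nat list \<Rightarrow> complex" where "low s = (\<Sum>m\<in>?N. ?q m * of_real (c m s))" for s
  \<comment> \<open>The tuples in \<open>W\<close> have length below \<open>p\<close>, so the two
    families never overlap and the depth \<open>p\<close> part of \<open>C\<close> is exactly
    \<open>DD\<close>.\<close>
  define C where "C s = (if length s = p then (if s \<in> tuples p then DD s else 0) else low s)" for s
  have finW: "finite W" using T(1) by (auto simp: W_def)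
  have admW: "adm p p (rev s) 0" if "s \<in> W" for s using that T(2) by (auto simp: W_def)
  have lenW: "length s < p" if "s \<in> W" for s using admW[OF that] by (simp add: adm_def)
  have lent: "length t = p" if "t \<in> tuples p" for t using that by (simp add: tuples_def)
  have low0: "low s = 0" if "s \<notin> W" for s
    using that T(4) by (auto simp: low_def W_def intro!: sum.neutral)
  have supp: "s \<in> tuples p \<or> s \<in> W" if "C s \<noteq> 0" for s
    using that low0[of s] by (auto simp: C_def split: if_splits)
  have admC: "adm p (Suc p) (rev s) 0" if "C s \<noteq> 0" for s
    using supp[OF that] adm_tuple[of s p] admW[of s] by (auto simp: adm_def)
  have sub: "{s. C s \<noteq> 0} \<subseteq> tuples p \<union> W" using supp by blast
  have fin: "finite {s. C s \<noteq> 0}" by (rule finite_subset[OF sub]) (simp add: finW)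
  have "?d m s \<in> \<rat>" if "m \<in> ?N" for m s using that by (intro Rats_prod D(1) dN) auto
  then have "DD s \<in> K" for s unfolding DD_def by (intro K_sum K_mult qK K_of_real)
  moreover have "low s \<in> K" for s unfolding low_def by (intro K_sum K_mult qK K_of_real T(3))
  ultimately have CK: "C s \<in> K" for s by (simp add: C_def K_0)
  have lowsum: "(\<Sum>s\<in>T m. c m s * mzv s) = (\<Sum>s\<in>W. c m s * mzv s)" if "m \<in> ?N" for m
    using that T(4) finW by (intro sum.mono_neutral_left) (auto simp: W_def)
  have "multiple_sum p A n r P = (\<Sum>m\<in>?N. ?q m * of_real (?S m))"
    by (rule multiple_sum_expansion[OF keys dN Q])
  also have "\<dots> = (\<Sum>m\<in>?N. (\<Sum>t\<in>tuples p. ?q m * of_real (?d m t) * of_real (mzv t)) +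
      (\<Sum>s\<in>W. ?q m * of_real (c m s) * of_real (mzv s)))"
    by (intro sum.cong refl) (simp only: T(5) lowsum of_real_add of_real_sum of_real_mult distrib_left
        sum_distrib_left mult.assoc)
  also have "\<dots> = (\<Sum>t\<in>tuples p. DD t * of_real (mzv t)) + (\<Sum>s\<in>W. low s * of_real (mzv s))"
    unfolding DD_def low_def sum_distrib_right sum.distrib
    by (intro arg_cong2[of _ _ _ _ "(+)"] sum.swap)
  also have "\<dots> = (\<Sum>t\<in>tuples p. C t * of_real (mzv t)) + (\<Sum>s\<in>W. C s * of_real (mzv s))"
    using lenW lent by (intro arg_cong2[of _ _ _ _ "(+)"] sum.cong refl) (auto simp: C_def)
  also have "\<dots> = (\<Sum>s\<in>tuples p \<union> W. C s * of_real (mzv s))"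
    using lenW lent finW by (intro sum.union_disjoint[symmetric]) auto
  also have "\<dots> = (\<Sum>s | C s \<noteq> 0. C s * of_real (mzv s))"
    using sub finW by (intro sum.mono_neutral_right) auto
  finally have S: "multiple_sum p A n r P = (\<Sum>s | C s \<noteq> 0. C s * of_real (mzv s))" .
  have adm: "admissible_representation K p A n r P (multiple_sum p A n r P) C"
    unfolding admissible_representation_def
  proof (intro conjI allI impI)
    fix s assume "C s \<noteq> 0"
    note ad = admC[OF this]
    show "length s \<le> p" using ad by (simp add: adm_def)
    show "\<forall>x\<in>set s. 1 \<le> x" using ad by (auto simp: adm_def)
    show "2 \<le> hd s" if "s \<noteq> []" using ad that by (simp add: adm_def)
  next
    fix s assume a: "C s \<noteq> 0 \<and> s \<noteq> []"
    then have ad: "adm p (Suc p) (rev s) 0" using admC by blast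
    show "\<exists>l :: nat \<Rightarrow> nat. l 0 = 1 \<and> l (length s) = p + 1 \<and>
           (\<forall>j<length s. l j < l (j + 1) \<and> s ! j \<le> (l (j + 1) - l j) * A)"
      using adm_chain[OF ad] a by blast
    show "\<forall>x\<in>set s. 1 \<le> x \<and> x \<le> A" if "\<forall>i. i + 1 < p \<longrightarrow> r i \<ge> r (i + 1) + n + 1"
    proof -
      have M using that unfolding M_def .
      with ad show ?thesis unfolding adm_def by fastforce
    qed
    have "{j. j < length s \<and> s ! j = 1} = {}"
      using ad nth_mem[of _ s] by (fastforce simp: adm_def)
    then show "card {j. j < length s \<and> s ! j = 1} \<le>
        card {i. i < p \<and> mdegree i P \<ge> ereal (real A * (real n + 1) - 1)}"
      by (simp only: card.empty le0)
  qed (use CK fin S in auto)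
  have top: "(\<Sum>s | C s \<noteq> 0 \<and> length s = p. C s * of_real (mzv s)) = (\<Sum>t\<in>tuples p. DD t * of_real (mzv t))"
  proof -
    have "(\<Sum>s | C s \<noteq> 0 \<and> length s = p. C s * of_real (mzv s)) = (\<Sum>t\<in>tuples p. C t * of_real (mzv t))"
      using lent by (intro sum.mono_neutral_left) (auto simp: C_def split: if_splits)
    then show ?thesis using lent by (simp add: C_def)
  qed
  have "(\<Sum>t\<in>tuples p. DD t * of_real (mzv t)) \<in> linear_combinations K
      {\<Sum>i<p. \<xi> ^ i * of_real (mzv (rotate i s)) | s. length s = p \<and> (\<forall>x\<in>set s. 2 \<le> x)}"
  proof (rule rotate_sum_combination[where \<xi> = \<xi> and d = DD and z = "\<lambda>t. of_real (mzv t)", OF subfield p finite_tuples _ _ sum_tuples_rotate])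
    fix t assume t: "t \<in> tuples p"
    show "DD t \<in> K" using CK[of t] lent[OF t] t by (simp add: C_def)
    show "(\<Sum>i<p. \<xi> ^ i * complex_of_real (mzv (rotate i t))) \<in>
        {\<Sum>i<p. \<xi> ^ i * of_real (mzv (rotate i s)) | s. length s = p \<and> (\<forall>x\<in>set s. 2 \<le> x)}"
    proof -
      have t2: "length t = p \<and> (\<forall>x\<in>set t. 2 \<le> x)" using t by (auto simp: tuples_def)
      show ?thesis by (rule CollectI, rule exI[of _ t], rule conjI[OF refl t2])
    qed
    have rot1: "DD (rotate1 t) = \<xi> * DD t" if len: "length t = p" for t
    proof -
      have "bij_betw (\<lambda>j. (j + 1) mod p) {..<p} {..<p}"
      proof -
        have inj: "inj_on (\<lambda>j. (j + 1) mod p) {..<p}"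
          by (rule inj_onI) (metis lessThan_iff rotate_index_inj)
        then have "(\<lambda>j. (j + 1) mod p) ` {..<p} = {..<p}"
          using p by (intro endo_inj_surj) auto
        then show ?thesis using inj by (simp add: bij_betw_def)
      qed
      note reindex = prod.reindex_bij_betw[OF this]
      \<comment> \<open>Reading the rotated tuple against \<open>m\<close> is the same as reading
        the tuple against the rotated \<open>m\<close>; \<open>qrot\<close> then supplies the factor
        \<open>\<xi>\<close>.\<close>
      have dm: "?d m (rotate1 t) = ?d (mono_rotate p m) t" if "m \<in> ?N" for m
      proof -
        have "?d m (rotate1 t) = (\<Prod>j<p. D (?e (mono_rotate p m) ((j + 1) mod p)) (t ! ((j + 1) mod p)))"
        proof (rule prod.cong)
          fix j assume "j \<in> {..<p}"
          then show "D (?e m j) (rotate1 t ! j) = D (?e (mono_rotate p m) ((j + 1) mod p)) (t ! ((j + 1) mod p))"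
            using lookup_mono_rotate[of m p j] keys that nth_rotate1[of j t] len by simp
        qed simp
        also have "\<dots> = ?d (mono_rotate p m) t" by (rule reindex)
        finally show ?thesis .
      qed
      have "DD (rotate1 t) = (\<Sum>m\<in>?N. \<xi> * (?q (mono_rotate p m) * of_real (?d (mono_rotate p m) t)))"
        unfolding DD_def
      proof (intro sum.cong refl)
        fix m assume m: "m \<in> ?N"
        show "?q m * of_real (?d m (rotate1 t)) =
            \<xi> * (?q (mono_rotate p m) * of_real (?d (mono_rotate p m) t))"
          by (subst qrot[OF m]) (simp only: dm[OF m] mult.assoc)
      qed
      also have "\<dots> = (\<Sum>m\<in>mono_rotate p ` ?N. \<xi> * (?q m * of_real (?d m t)))"
        using keys inj_on_subset[OF mono_rotate_inj[of p], of ?N] by (subst sum.reindex) auto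
      also have "mono_rotate p ` ?N = ?N"
        using rotN keys inj_on_subset[OF mono_rotate_inj[of p], of ?N] by (intro endo_inj_surj) auto
      finally show ?thesis by (simp add: DD_def sum_distrib_left)
    qed
    show "DD (rotate i t) = \<xi> ^ i * DD t" for i
      by (induction i) (use rot1 lent[OF t] in auto)
  qed
  then show ?thesis
    unfolding K_def[symmetric] by (intro exI[of _ C] conjI[OF adm]) (simp only: top)
qed

theorem theorem3p7:
  fixes p A n :: nat and r :: "nat \<Rightarrow> nat" and \<xi> :: complex and P Q :: cmpoly
  assumes "p \<ge> 1"
    and "\<xi> \<noteq> 0" and "\<xi> ^ p = 1"
    and "P \<in> mpolys_over (rat_adjoin \<xi>) p"
    and "\<forall>j\<in>{1..p}. (\<Sum>i<j. mdegree i P)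
           \<le> ereal (real j * real A * (real n + 1) - real j - 1)"
    and "Q = msubst (\<lambda>i. mVar i - mConst (of_nat (r i) + of_nat n / 2)) P"
    and "msubst (\<lambda>i. mVar ((i + 1) mod p)) Q = mConst \<xi> * Q"
  shows "\<exists>c. admissible_representation (rat_adjoin \<xi>) p A n r P (multiple_sum p A n r P) c \<and>
           (\<Sum>s | c s \<noteq> 0 \<and> length s = p. c s * of_real (mzv s))
             \<in> linear_combinations (rat_adjoin \<xi>)
                 {\<Sum>i<p. \<xi> ^ i * of_real (mzv (rotate i s)) | s.
                    length s = p \<and> (\<forall>x\<in>set s. 2 \<le> x)}"
proof -
  have deg: "Poly_Mapping.lookup m 0 + 2 \<le> A * (n + 1)" if "m \<in> Poly_Mapping.keys P" for m
  proof -
    have "ereal (real (Poly_Mapping.lookup m 0)) \<le> mdegree 0 P"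
      unfolding mdegree_def using that by (rule SUP_upper)
    also have "\<dots> \<le> ereal (real A * (real n + 1) - 2)"
      using assms(5)[rule_format, of 1] assms(1) by simp
    finally have "real (Poly_Mapping.lookup m 0 + 2) \<le> real (A * (n + 1))" by (simp add: algebra_simps)
    then show ?thesis by (simp only: of_nat_le_iff)
  qed
  show ?thesis
  \<comment> \<open>The zero polynomial is set aside because it allows \<open>A = 0\<close>, while a
    monomial of \<open>P\<close> forces \<open>A\<close> to be positive.\<close>
  proof (cases "P = 0")
    case True
    interpret subfield "rat_adjoin \<xi>" by standard (rule subfield_rat_adjoin)
    have "admissible_representation (rat_adjoin \<xi>) p A n r P (multiple_sum p A n r P) (\<lambda>_. 0)"
      by (simp add: admissible_representation_def multiple_sum_def True K_0)
    moreover have "0 \<in> linear_combinations (rat_adjoin \<xi>) X" for X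
      using linear_combinations_sum[of "{}" "\<lambda>_. 0" "\<lambda>_. 0" X] by simp
    ultimately show ?thesis by (intro exI[of _ "\<lambda>_. 0"]) simp
  next
    case False
    then obtain m where "m \<in> Poly_Mapping.keys P" by fastforce
    then have "1 \<le> A" using deg[of m] by (cases A) auto
    then show ?thesis
      using admissible_representation_exists[OF assms(1) _ assms(4) deg assms(6,7)] by blast
  qed
qed

end
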